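(* Let $0<s<1$ and $1<p<\infty$. Let $u$ be an analytic function in the open unit disc $\mathbb{D}$, and for $0<r<1$ let $u_r:\mathbb{S}^1\to\mathbb{C}$, $u_r(\xi):=u(r\xi)$ (each $u_r$ is smooth on $\mathbb{S}^1$, so it lies in $W^{s,p}(\mathbb{S}^1)$). Assume that $$\sup_{0<r<1}[u_r]_{W^{s,p}(\mathbb{S}^1)}<+\infty.$$ Then the following hold. 1. $u$ belongs to the Hardy space $\mathbf{H}^p(\mathbb{D})$, and in particular admits a radial boundary trace $u^*\in L^p(\mathbb{S}^1)$ satisfying $$\lim_{r\to1^-}u(re^{i\theta})=u^*(e^{i\theta})\quad\text{for almost every }\theta\in(-\pi,\pi),$$ with convergence also in $L^p(\mathbb{S}^1)$ (that is, $u_r\to u^*$ in $L^p(\mathbb{S}^1)$ as $r\to1^-$). 2. $u^*\in W^{s,p}(\mathbb{S}^1)$. 3. $\lim_{r\to1^-}[u_r-u^*]_{W^{s,p}(\mathbb{S}^1)}=0$, and in particular $[u_r]_{W^{s,p}(\mathbb{S}^1)}\to[u^*]_{W^{s,p}(\mathbb{S}^1)}$ as $r\to1^-$.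
   Context: $\mathbb{D}$ is the open unit disc in $\mathbb{C}$ and $\mathbb{S}^1$ the unit circle. $L^p(\mathbb{S}^1)$ consists of complex-valued functions, with $\|f\|_{L^p(\mathbb{S}^1)}^p=\int_{-\pi}^{\pi}|f(e^{i\theta})|^p\,d\theta$. The Gagliardo seminorm is $$[f]_{W^{s,p}(\mathbb{S}^1)}:=\left(\int_{-\pi}^{\pi}\int_{-\pi}^{\pi}\frac{|f(e^{i\xi})-f(e^{i\sigma})|^p}{|e^{i\xi}-e^{i\sigma}|^{1+sp}}\,d\xi\,d\sigma\right)^{1/p},$$ and $W^{s,p}(\mathbb{S}^1):=\{f\in L^p(\mathbb{S}^1):[f]_{W^{s,p}(\mathbb{S}^1)}<\infty\}$. The Hardy space $\mathbf{H}^p(\mathbb{D})$ is the set of analytic $f$ on $\mathbb{D}$ with $\|f\|_{\mathbf{H}^p(\mathbb{D})}:=\sup_{0\le r<1}\left(\frac1{2\pi}\int_0^{2\pi}|f(re^{i\theta})|^p\,d\theta\right)^{1/p}<\infty$. *)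

theory Defs
  imports "HOL-Analysis.Analysis"
begin

text \<open>
  Functions on the unit circle are represented by functions \<open>complex \<Rightarrow> complex\<close>, which are only
  ever evaluated at the points \<open>cis \<theta>\<close>. Norms and seminorms take values in \<open>ennreal\<close>, so that
  they are meaningful (possibly \<open>\<infinity>\<close>) for every measurable function.
\<close>

text \<open>Meant for \<open>a > 0\<close> only: then \<open>\<infinity> powr a = \<infinity>\<close> and \<open>0 powr a = 0\<close>.\<close>

definition ennreal_powr :: "ennreal \<Rightarrow> real \<Rightarrow> ennreal" where
  "ennreal_powr x a = (if x = \<infinity> then \<infinity> else ennreal (enn2real x powr a))"

definition Lp_norm_circle :: "real \<Rightarrow> (complex \<Rightarrow> complex) \<Rightarrow> ennreal" where
  "Lp_norm_circle p f =
     ennreal_powr (\<integral>\<^sup>+\<theta>\<in>{-pi..pi}. ennreal (norm (f (cis \<theta>)) powr p) \<partial>lebesgue) (1 / p)"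

definition Lp_circle :: "real \<Rightarrow> (complex \<Rightarrow> complex) set" where
  "Lp_circle p =
     {f. (\<lambda>\<theta>. f (cis \<theta>)) \<in> borel_measurable (lebesgue_on {-pi..pi}) \<and> Lp_norm_circle p f < \<infinity>}"

text \<open>
  On the null set where the denominator vanishes, the quotient below is \<open>0\<close>, as division by
  zero is zero in \<open>real\<close>.
\<close>

definition gagliardo_seminorm :: "real \<Rightarrow> real \<Rightarrow> (complex \<Rightarrow> complex) \<Rightarrow> ennreal" where
  "gagliardo_seminorm s p f =
     ennreal_powr
       (\<integral>\<^sup>+\<sigma>\<in>{-pi..pi}. (\<integral>\<^sup>+\<xi>\<in>{-pi..pi}.
            ennreal (norm (f (cis \<xi>) - f (cis \<sigma>)) powr p
                     / norm (cis \<xi> - cis \<sigma>) powr (1 + s * p)) \<partial>lebesgue) \<partial>lebesgue)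
       (1 / p)"

definition sobolev_circle :: "real \<Rightarrow> real \<Rightarrow> (complex \<Rightarrow> complex) set" where
  "sobolev_circle s p = {f \<in> Lp_circle p. gagliardo_seminorm s p f < \<infinity>}"

definition hardy_norm :: "real \<Rightarrow> (complex \<Rightarrow> complex) \<Rightarrow> ennreal" where
  "hardy_norm p f =
     (SUP r\<in>{0..<1}. ennreal_powr
        (ennreal (1 / (2 * pi)) *
         (\<integral>\<^sup>+\<theta>\<in>{0..2 * pi}. ennreal (norm (f (of_real r * cis \<theta>)) powr p) \<partial>lebesgue))
        (1 / p))"

definition hardy_space :: "real \<Rightarrow> (complex \<Rightarrow> complex) set" where
  "hardy_space p = {f. f analytic_on ball 0 1 \<and> hardy_norm p f < \<infinity>}"

definition dilate :: "(complex \<Rightarrow> complex) \<Rightarrow> real \<Rightarrow> complex \<Rightarrow> complex" where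
  "dilate u r \<xi> = u (of_real r * \<xi>)"

end

theory Submission
  imports Defs "HOL-Complex_Analysis.Cauchy_Integral_Formula" "HOL-Real_Asymp.Real_Asymp"
begin

text \<open>
  Cauchy's formula for \<open>u'\<close>, applied to \<open>u - u (\<rho> e\<^sup>i\<^sup>\<theta>)\<close> on the circle of radius \<open>\<rho>\<close> and integrated
  along a radius, bounds the radial variation \<open>g \<theta> = \<integral> \<bar>u' (r e\<^sup>i\<^sup>\<theta>)\<bar> dr\<close> by
  \<open>\<integral> \<bar>u\<^sub>\<rho> (\<theta> + t) - u\<^sub>\<rho> \<theta>\<bar> / \<bar>t\<bar> dt\<close>. Jensen's inequality with a suitable power weight then bounds
  \<open>\<integral> g\<^sup>p\<close> by the Gagliardo integral of \<open>u\<^sub>\<rho>\<close>. Hence \<open>g\<close> is in \<open>L\<^sup>p\<close>: radial limits exist almost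
  everywhere, and \<open>\<bar>u 0\<bar> + g\<close> dominates all \<open>u\<^sub>r\<close>, which gives the Hardy bound and \<open>L\<^sup>p\<close> convergence
  without maximal functions.

  For the seminorms, write the Gagliardo integral as a weighted integral over \<open>t\<close> of
  \<open>m\<^sub>r t = \<integral> \<bar>u\<^sub>r (\<theta> + t) - u\<^sub>r \<theta>\<bar>\<^sup>p d\<theta>\<close>. By Poisson's formula and Jensen, \<open>m\<^sub>r t\<close> increases with \<open>r\<close>
  to the corresponding integral for the trace; that limit has finite weighted integral by Fatou, so
  dominated convergence in \<open>t\<close> gives convergence of the seminorms.
\<close>

subsection \<open>Integration over a period\<close>

text \<open>Lebesgue measure on one period, encoded as a density on the whole line: its
  sigma-algebra stays \<open>borel\<close>, so integrands on the line and their translates are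
  measurable without restricting domains.\<close>

definition arc_measure :: "real measure" where
  "arc_measure = density lborel (indicator {-pi..pi})"

lemma sets_arc [simp, measurable_cong]: "sets arc_measure = sets borel"
  by (simp add: arc_measure_def)

lemma space_arc [simp]: "space arc_measure = UNIV"
  by (simp add: arc_measure_def)

lemma nn_integral_arc:
  assumes [measurable]: "f \<in> borel_measurable borel"
  shows "(\<integral>\<^sup>+x. f x \<partial>arc_measure) = (\<integral>\<^sup>+x\<in>{-pi..pi}. f x \<partial>lborel)"
  unfolding arc_measure_def by (subst nn_integral_density) (auto simp: mult.commute)

lemma finite_measure_arc: "finite_measure arc_measure"
proof
  have "emeasure arc_measure (space arc_measure) = emeasure lborel {-pi..pi}"
    unfolding arc_measure_def by (subst emeasure_density) auto
  then show "emeasure arc_measure (space arc_measure) \<noteq> \<infinity>" by simp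
qed

interpretation arc: finite_measure arc_measure by (rule finite_measure_arc)

interpretation arc_pair: pair_sigma_finite arc_measure arc_measure ..

lemma emeasure_arc_UNIV: "emeasure arc_measure UNIV = ennreal (2 * pi)"
  unfolding arc_measure_def by (subst emeasure_density) auto

lemma AE_arc_measureI:
  assumes "\<And>x. -pi \<le> x \<Longrightarrow> x \<le> pi \<Longrightarrow> P x"
  shows "AE x in arc_measure. P x"
  unfolding arc_measure_def by (subst AE_density) (auto simp: indicator_def assms)

lemma nn_integral_arc_rotate:
  \<comment> \<open>Whole periods are removed from the shift \<open>a\<close>, leaving
    \<open>0 \<le> b \<le> 2 * pi\<close>; the part of the shifted interval that sticks out beyond
    \<open>pi\<close> is then moved back by one period.\<close>
  fixes h :: "real \<Rightarrow> ennreal"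
  assumes [measurable]: "h \<in> borel_measurable borel" and per: "\<And>x. h (x + 2 * pi) = h x"
  shows "(\<integral>\<^sup>+x. h (x + a) \<partial>arc_measure) = (\<integral>\<^sup>+x. h x \<partial>arc_measure)"
proof -
  have perk: "h (x + 2 * pi * real_of_int k) = h x" for x k
  proof (induction k arbitrary: x rule: int_induct[where k = 0])
    case (step1 i)
    have "h (x + 2 * pi * real_of_int (i + 1)) = h ((x + 2 * pi * real_of_int i) + 2 * pi)"
      by (simp add: algebra_simps)
    with step1 per show ?case by simp
  next
    case (step2 i)
    have "h (x + 2 * pi * real_of_int (i - 1)) = h ((x + 2 * pi * real_of_int (i - 1)) + 2 * pi)"
      by (simp add: per)
    also have "\<dots> = h (x + 2 * pi * real_of_int i)" by (simp add: algebra_simps)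
    finally show ?case using step2 by simp
  qed simp
  have shift: "(\<integral>\<^sup>+x\<in>{l..<r}. g (x + c) \<partial>lborel) = (\<integral>\<^sup>+x\<in>{l + c..<r + c}. g x \<partial>lborel)"
    if [measurable]: "g \<in> borel_measurable borel" for g :: "real \<Rightarrow> ennreal" and l r c
  proof -
    have "(\<integral>\<^sup>+x\<in>{l + c..<r + c}. g x \<partial>lborel)
        = (\<integral>\<^sup>+x. g (c + 1 * x) * indicator {l + c..<r + c} (c + 1 * x) \<partial>lborel)"
      by (subst nn_integral_real_affine[where c = 1 and t = c]) auto
    also have "\<dots> = (\<integral>\<^sup>+x\<in>{l..<r}. g (x + c) \<partial>lborel)"
      by (intro nn_integral_cong) (auto simp: indicator_def add.commute)
    finally show ?thesis ..
  qed
  \<comment> \<open>Half-open intervals can be cut and reassembled without overlaps; only the null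
    point \<open>pi\<close> is lost.\<close>
  have halfopen: "(\<integral>\<^sup>+x. g x \<partial>arc_measure) = (\<integral>\<^sup>+x\<in>{-pi..<pi}. g x \<partial>lborel)"
    if [measurable]: "g \<in> borel_measurable borel" for g :: "real \<Rightarrow> ennreal"
    unfolding nn_integral_arc[OF that]
    by (rule nn_integral_cong_AE, rule AE_mp[OF AE_lborel_singleton[of pi]]) (auto simp: indicator_def)
  have split: "(\<integral>\<^sup>+x\<in>{l..<r}. g x \<partial>lborel)
      = (\<integral>\<^sup>+x\<in>{l..<m}. g x \<partial>lborel) + (\<integral>\<^sup>+x\<in>{m..<r}. g x \<partial>lborel)"
    if [measurable]: "g \<in> borel_measurable borel" and "l \<le> m" "m \<le> r" for g :: "real \<Rightarrow> ennreal" and l m r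
    using that by (subst nn_integral_add[symmetric]) (auto intro!: nn_integral_cong simp: indicator_def)
  define k where "k = \<lfloor>a / (2 * pi)\<rfloor>"
  define b where "b = a - 2 * pi * real_of_int k"
  have "real_of_int k \<le> a / (2 * pi)" "a / (2 * pi) < real_of_int k + 1"
    unfolding k_def by linarith+
  then have b: "0 \<le> b" "b \<le> 2 * pi"
    by (auto simp: b_def field_simps)
  have "h (x + a) = h (x + b)" for x
    using perk[of "x + b" k] by (simp add: b_def)
  then have "(\<integral>\<^sup>+x. h (x + a) \<partial>arc_measure) = (\<integral>\<^sup>+x. h (x + b) \<partial>arc_measure)"
    by simp
  also have "\<dots> = (\<integral>\<^sup>+x\<in>{-pi + b..<pi + b}. h x \<partial>lborel)"
    by (subst halfopen, simp, subst shift) auto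
  also have "\<dots> = (\<integral>\<^sup>+x\<in>{-pi + b..<pi}. h x \<partial>lborel) + (\<integral>\<^sup>+x\<in>{pi..<pi + b}. h x \<partial>lborel)"
    using b by (intro split) auto
  also have "(\<integral>\<^sup>+x\<in>{pi..<pi + b}. h x \<partial>lborel) = (\<integral>\<^sup>+x\<in>{-pi..<-pi + b}. h (x + 2 * pi) \<partial>lborel)"
    by (subst shift) (auto simp: algebra_simps)
  also have "\<dots> = (\<integral>\<^sup>+x\<in>{-pi..<-pi + b}. h x \<partial>lborel)"
    by (simp add: per)
  also have "(\<integral>\<^sup>+x\<in>{-pi + b..<pi}. h x \<partial>lborel) + (\<integral>\<^sup>+x\<in>{-pi..<-pi + b}. h x \<partial>lborel)
      = (\<integral>\<^sup>+x\<in>{-pi..<pi}. h x \<partial>lborel)"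
    using b by (subst split[of h "-pi" "-pi + b" pi]) (auto simp: add.commute)
  also have "\<dots> = (\<integral>\<^sup>+x. h x \<partial>arc_measure)"
    by (simp add: halfopen)
  finally show ?thesis .
qed

section \<open>Jensen's inequality for a weight of finite mass\<close>

text \<open>The convex function \<open>y powr p\<close> lies above its tangent at \<open>a\<close>.
  This is Young's inequality for \<open>y\<close> and \<open>a powr (p - 1)\<close> with the
  conjugate exponent \<open>q = p / (p - 1)\<close>.\<close>

lemma powr_tangent:
  fixes p :: real
  assumes "1 < p" "0 \<le> y" "0 < a"
  shows "p * a powr (p - 1) * y \<le> y powr p + (p - 1) * a powr p"
proof -
  define q where "q = p / (p - 1)"
  have q: "q > 0" "1 / p + 1 / q = 1" "1 < q" using assms by (auto simp: q_def field_simps)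
  have "y * a powr (p - 1) \<le> y powr p / p + (a powr (p - 1)) powr q / q"
    using Youngs_inequality[of p q y "a powr (p - 1)"] assms q by auto
  moreover have "(a powr (p - 1)) powr q = a powr p"
    using assms by (simp add: powr_powr q_def)
  ultimately have "p * (y * a powr (p - 1)) \<le> p * (y powr p / p + a powr p / q)"
    using assms by (intro mult_left_mono) auto
  also have "\<dots> = y powr p + (p - 1) * a powr p"
    using assms by (simp add: field_simps q_def)
  finally show ?thesis by (simp add: mult_ac)
qed

text \<open>Jensen's inequality for the weight \<open>w\<close> of total mass \<open>W\<close>:
  multiply the tangent inequality by \<open>w\<close> and integrate. A real \<open>x\<close> below
  the integral stands in for the integral itself, which may be infinite.\<close>

lemma nn_integral_powr_le:
  fixes f w :: "'a \<Rightarrow> real"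
  assumes [measurable]: "f \<in> borel_measurable M" "w \<in> borel_measurable M"
    and f: "\<And>x. 0 \<le> f x" and w: "\<And>x. 0 \<le> w x" and p: "1 < p" and "0 \<le> x" "0 \<le> W"
    and x: "ennreal x \<le> (\<integral>\<^sup>+y. ennreal (f y * w y) \<partial>M)"
    and W: "(\<integral>\<^sup>+y. ennreal (w y) \<partial>M) = ennreal W"
  shows "ennreal (x powr p) \<le> ennreal (W powr (p - 1)) * (\<integral>\<^sup>+y. ennreal (f y powr p * w y) \<partial>M)"
proof (cases "x = 0 \<or> W = 0")
  case True
  show ?thesis
  proof (cases "x = 0")
    case False
    with True W have "AE y in M. w y = 0"
      using nn_integral_0_iff_AE[of "\<lambda>y. ennreal (w y)" M] by (auto simp: w ennreal_eq_0_iff antisym)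
    then have "(\<integral>\<^sup>+y. ennreal (f y * w y) \<partial>M) = 0"
      by (subst nn_integral_0_iff_AE) (auto elim: AE_mp)
    with x False \<open>0 \<le> x\<close> show ?thesis by (simp add: ennreal_eq_0_iff)
  qed (use p in auto)
next
  case False
  then have pos: "0 < x" "0 < W" using assms by auto
  let ?B = "\<integral>\<^sup>+y. ennreal (f y powr p * w y) \<partial>M"
  show ?thesis
  proof (cases "?B = \<infinity>")
    case True
    with pos show ?thesis by (simp add: ennreal_mult_top)
  next
    case False
    then obtain B where B: "?B = ennreal B" "0 \<le> B"
      by (metis ennreal_cases infinity_ennreal_def)
    \<comment> \<open>The best point of tangency is the mean value of \<open>f\<close> with respect
      to \<open>w / W\<close>, with \<open>x\<close> in place of the integral.\<close>
    define a where "a = x / W"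
    have a: "0 < a" using pos by (simp add: a_def)
    have "ennreal (p * a powr (p - 1) * x) = ennreal (p * a powr (p - 1)) * ennreal x"
      using p pos by (intro ennreal_mult) auto
    also have "\<dots> \<le> ennreal (p * a powr (p - 1)) * (\<integral>\<^sup>+y. ennreal (f y * w y) \<partial>M)"
      by (intro mult_left_mono x) auto
    also have "\<dots> = (\<integral>\<^sup>+y. ennreal (p * a powr (p - 1) * (f y * w y)) \<partial>M)"
      using p f w by (subst nn_integral_cmult[symmetric]) (auto simp: ennreal_mult')
    also have "\<dots> \<le> (\<integral>\<^sup>+y. ennreal (f y powr p * w y) + ennreal ((p - 1) * a powr p) * ennreal (w y) \<partial>M)"
    proof (intro nn_integral_mono)
      fix y
      have "p * a powr (p - 1) * f y * w y \<le> (f y powr p + (p - 1) * a powr p) * w y"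
        by (intro mult_right_mono powr_tangent p f w a)
      then have "ennreal (p * a powr (p - 1) * (f y * w y)) \<le> ennreal (f y powr p * w y + (p - 1) * a powr p * w y)"
        by (intro ennreal_leI) (simp add: algebra_simps)
      also have "\<dots> = ennreal (f y powr p * w y) + ennreal ((p - 1) * a powr p) * ennreal (w y)"
        using p w f by (subst ennreal_plus) (auto simp: ennreal_mult')
      finally show "ennreal (p * a powr (p - 1) * (f y * w y))
        \<le> ennreal (f y powr p * w y) + ennreal ((p - 1) * a powr p) * ennreal (w y)" .
    qed
    also have "\<dots> = ennreal B + ennreal ((p - 1) * a powr p) * ennreal W"
      by (subst nn_integral_add) (auto simp: nn_integral_cmult W B)
    also have "\<dots> = ennreal (B + (p - 1) * a powr p * W)"
      using p B pos by (simp add: ennreal_mult' ennreal_plus)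
    \<comment> \<open>Since \<open>x = a * W\<close>, the left side is
      \<open>p * a powr p * W\<close>, and all but one copy of \<open>a powr p * W\<close>
      cancels.\<close>
    finally have "p * a powr (p - 1) * x \<le> B + (p - 1) * a powr p * W"
      using B p pos by (subst (asm) ennreal_le_iff) auto
    moreover have "x = a * W" using pos by (simp add: a_def)
    moreover have "a powr (p - 1) * a = a powr p" using a by (simp add: powr_diff)
    ultimately have "a powr p * W \<le> B"
      by (simp add: algebra_simps) (smt (verit, ccfv_SIG) mult.assoc mult.commute)
    then have "W powr (p - 1) * (a powr p * W) \<le> W powr (p - 1) * B"
      by (intro mult_left_mono) auto
    moreover have "W powr (p - 1) * (a powr p * W) = x powr p"
      using pos by (simp add: a_def powr_divide powr_diff)
    ultimately have "ennreal (x powr p) \<le> ennreal (W powr (p - 1) * B)"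
      by (intro ennreal_leI) simp
    also have "\<dots> = ennreal (W powr (p - 1)) * ?B"
      using B by (simp add: ennreal_mult)
    finally show ?thesis .
  qed
qed

subsection \<open>Poisson and Cauchy integrals\<close>

lemma nn_integral_arc_0_2pi:
  fixes h :: "real \<Rightarrow> ennreal"
  assumes [measurable]: "h \<in> borel_measurable borel" and per: "\<And>x. h (x + 2 * pi) = h x"
  shows "(\<integral>\<^sup>+x\<in>{0..2 * pi}. h x \<partial>lborel) = (\<integral>\<^sup>+x. h x \<partial>arc_measure)"
proof -
  have "(\<integral>\<^sup>+x\<in>{0..2 * pi}. h x \<partial>lborel) = (\<integral>\<^sup>+x. h (pi + 1 * x) * indicator {0..2 * pi} (pi + 1 * x) \<partial>lborel)"
    by (subst nn_integral_real_affine[where c = 1 and t = pi]) auto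
  also have "\<dots> = (\<integral>\<^sup>+x\<in>{-pi..pi}. h (x + pi) \<partial>lborel)"
    by (intro nn_integral_cong) (auto simp: indicator_def add.commute)
  also have "\<dots> = (\<integral>\<^sup>+x. h (x + pi) \<partial>arc_measure)"
    by (subst nn_integral_arc) auto
  also have "\<dots> = (\<integral>\<^sup>+x. h x \<partial>arc_measure)"
    by (rule nn_integral_arc_rotate) (auto simp: per)
  finally show ?thesis .
qed

lemma cis_add_2pi [simp]: "cis (x + 2 * pi) = cis x"
  by (simp add: complex_eq_iff)

lemma borel_measurable_cis [measurable]: "cis \<in> borel_measurable borel"
  by (intro borel_measurable_continuous_onI continuous_intros)

text \<open>Passes from gauge integrals, in which contour integrals and the fundamental theorem of
  calculus are stated, to nonnegative Lebesgue integrals.\<close>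

lemma norm_has_integral_le_nn_integral:
  fixes g :: "real \<Rightarrow> 'a::euclidean_space"
  assumes I: "(g has_integral I) {a..b}" and cont: "continuous_on {a..b} g"
  shows "ennreal (norm I) \<le> (\<integral>\<^sup>+x\<in>{a..b}. ennreal (norm (g x)) \<partial>lborel)"
proof -
  have "(\<lambda>x. norm (g x)) integrable_on {a..b}"
    by (intro integrable_continuous_interval continuous_intros cont)
  then obtain J where J: "((\<lambda>x. norm (g x)) has_integral J) {a..b}" by blast
  have "norm I \<le> J"
    using integral_norm_bound_integral[of g "{a..b}" "\<lambda>x. norm (g x)"] I J
    by (metis has_integral_integrable_integral order_refl)
  then have "ennreal (norm I) \<le> ennreal J" by (rule ennreal_leI)
  also have "\<dots> = (\<integral>\<^sup>+x\<in>{a..b}. ennreal (norm (g x)) \<partial>lborel)"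
    using nn_integral_has_integral_lebesgue'[OF _ J] by simp
  finally show ?thesis .
qed

lemma norm_has_integral_le_nn_integral_arc:
  fixes g :: "real \<Rightarrow> complex"
  assumes I: "(g has_integral I) {0..2 * pi}" and cont: "continuous_on UNIV g"
    and per: "\<And>x. g (x + 2 * pi) = g x"
  shows "ennreal (norm I) \<le> (\<integral>\<^sup>+x. ennreal (norm (g x)) \<partial>arc_measure)"
proof -
  have [measurable]: "g \<in> borel_measurable borel"
    using cont by (rule borel_measurable_continuous_onI)
  have "ennreal (norm I) \<le> (\<integral>\<^sup>+x\<in>{0..2 * pi}. ennreal (norm (g x)) \<partial>lborel)"
    by (intro norm_has_integral_le_nn_integral I continuous_on_subset[OF cont]) auto
  also have "\<dots> = (\<integral>\<^sup>+x. ennreal (norm (g x)) \<partial>arc_measure)"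
    by (rule nn_integral_arc_0_2pi) (auto simp: per)
  finally show ?thesis .
qed

lemma norm_cis_diff_pos: "norm z < 1 \<Longrightarrow> 0 < norm (cis t - z)"
  by (metis norm_cis order_less_irrefl right_minus_eq zero_less_norm_iff)

text \<open>Cauchy's formula for \<open>v w / (1 - cnj z * w)\<close>: on the unit circle
  \<open>1 - cnj z * w = w * cnj (w - z)\<close>.\<close>

lemma poisson_integral_formula:
  assumes cont: "continuous_on (cball 0 1) v" and hol: "v holomorphic_on ball 0 1" and z: "norm z < 1"
  shows "((\<lambda>t. v (cis t) / of_real ((norm (cis t - z))\<^sup>2)) has_integral
           of_real (2 * pi / (1 - (norm z)\<^sup>2)) * v z) {0..2 * pi}"
proof -
  have nz: "1 - cnj z * w \<noteq> 0" if "norm w \<le> 1" for w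
  proof
    assume "1 - cnj z * w = 0"
    then have "norm (cnj z * w) = 1" by (metis norm_one right_minus_eq)
    moreover have "norm z * norm w \<le> norm z * 1" using that by (intro mult_left_mono) auto
    ultimately show False using z by (simp add: norm_mult)
  qed
  let ?f = "\<lambda>w. v w / (1 - cnj z * w)"
  have "((\<lambda>w. ?f w / (w - z)) has_contour_integral (2 * of_real pi * \<i> * ?f z)) (circlepath 0 1)"
    using z nz by (intro Cauchy_integral_circlepath continuous_intros cont holomorphic_intros hol) auto
  then have *: "((\<lambda>t. ?f (0 + of_real 1 * cis t) / ((0 + of_real 1 * cis t) - z) * of_real 1 * \<i> * cis t)
       has_integral (2 * of_real pi * \<i> * ?f z)) {0..2 * pi}"
    unfolding circlepath_def by (subst (asm) has_contour_integral_part_circlepath_iff) auto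
  \<comment> \<open>The factor \<open>-\<i>\<close> cancels the \<open>\<i>\<close> of the
    parametrisation and turns \<open>2 * pi * \<i>\<close> into \<open>2 * pi\<close>.\<close>
  have "((\<lambda>t. -\<i> * (?f (0 + of_real 1 * cis t) / ((0 + of_real 1 * cis t) - z) * of_real 1 * \<i> * cis t))
       has_integral (-\<i> * (2 * of_real pi * \<i> * ?f z))) {0..2 * pi}"
    by (intro has_integral_mult_right *)
  also have "-\<i> * (2 * of_real pi * \<i> * ?f z) = of_real (2 * pi / (1 - (norm z)\<^sup>2)) * v z"
  proof -
    have "cnj z * z = of_real ((norm z)\<^sup>2)" using complex_norm_square[of z] by (simp add: mult.commute)
    moreover have "-\<i> * (2 * a * \<i> * x) = 2 * a * x" for a x by (simp add: complex_eq_iff)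
    then have "-\<i> * (2 * of_real pi * \<i> * ?f z) = 2 * of_real pi * ?f z" .
    ultimately show ?thesis by simp
  qed
  also have "(\<lambda>t. -\<i> * (?f (0 + of_real 1 * cis t) / ((0 + of_real 1 * cis t) - z) * of_real 1 * \<i> * cis t))
      = (\<lambda>t. v (cis t) / of_real ((norm (cis t - z))\<^sup>2))"
  proof
    fix t
    have eq: "1 - cnj z * cis t = cis t * cnj (cis t - z)"
      by (simp add: algebra_simps cis_mult cis_cnj)
    have "cis t - z \<noteq> 0" using norm_cis_diff_pos[OF z, of t] by auto
    then have "cnj (cis t - z) \<noteq> 0" by (metis complex_cnj_zero_iff)
    moreover have "\<i> * (x * \<i>) = - x" for x by (simp add: complex_eq_iff)
    ultimately show "-\<i> * (?f (0 + of_real 1 * cis t) / ((0 + of_real 1 * cis t) - z) * of_real 1 * \<i> * cis t)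
       = v (cis t) / of_real ((norm (cis t - z))\<^sup>2)"
      unfolding complex_norm_square by (simp add: eq mult.commute[of "cnj (cis t - z)"] del: complex_cnj_diff)
  qed
  finally show ?thesis .
qed

lemma continuous_on_cis_compose:
  assumes "continuous_on (sphere 0 1) v"
  shows "continuous_on UNIV (\<lambda>t. v (cis t))"
  by (rule continuous_on_compose2[OF assms]) (auto intro!: continuous_intros)

text \<open>Each value inside the disc is a Poisson average of boundary values. Jensen moves the
  \<open>p\<close>-th power inside the average; Fubini and rotation invariance then leave only the
  total mass 1 of the kernel.\<close>

lemma nn_integral_arc_mean_le:
  assumes cont: "continuous_on (cball 0 1) v" and hol: "v holomorphic_on ball 0 1"
    and r: "0 \<le> r" "r < 1" and p: "1 < p"
  shows "(\<integral>\<^sup>+\<theta>. ennreal (norm (v (of_real r * cis \<theta>)) powr p) \<partial>arc_measure)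
       \<le> (\<integral>\<^sup>+\<theta>. ennreal (norm (v (cis \<theta>)) powr p) \<partial>arc_measure)"
proof -
  \<comment> \<open>The Poisson kernel for the real point \<open>r\<close>, normalised to have
    integral 1 over a period.\<close>
  define w where "w = (\<lambda>t. (1 - r\<^sup>2) / (2 * pi) / (norm (cis t - of_real r))\<^sup>2)"
  define c where "c = (1 - r\<^sup>2) / (2 * pi)"
  have c: "0 < c" using r by (simp add: c_def power_less_one_iff)
  have c': "c * (2 * pi / (1 - r\<^sup>2)) = 1"
    using r power_less_one_iff[of r 2] by (simp add: c_def)
  have w0: "0 \<le> w t" for t using c by (simp add: w_def flip: c_def)
  have d: "0 < norm (cis t - of_real r)" for t using r by (intro norm_cis_diff_pos) auto
  have wcont: "continuous_on UNIV w"
    unfolding w_def using d by (auto intro!: continuous_intros)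
  then have [measurable]: "w \<in> borel_measurable borel" by (rule borel_measurable_continuous_onI)
  have "continuous_on UNIV (\<lambda>t. v (cis t))"
    by (intro continuous_on_cis_compose continuous_on_subset[OF cont]) auto
  then have vm[measurable]: "(\<lambda>t. v (cis t)) \<in> borel_measurable borel" by (rule borel_measurable_continuous_onI)
  have wper: "w (x + 2 * pi) = w x" for x by (simp add: w_def)
  define F where "F = (\<lambda>t. v (cis t))"
  have Fc: "continuous_on UNIV F" and [measurable]: "F \<in> borel_measurable borel"
    using \<open>continuous_on UNIV (\<lambda>t. v (cis t))\<close> vm by (simp_all add: F_def)
  \<comment> \<open>The mass is read off from Poisson's formula for the constant function 1.\<close>
  have w1: "(\<integral>\<^sup>+t. ennreal (w t) \<partial>arc_measure) = ennreal 1"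
  proof -
    have "((\<lambda>t. 1 / of_real ((norm (cis t - of_real r))\<^sup>2) :: complex) has_integral
           of_real (2 * pi / (1 - (norm (of_real r :: complex))\<^sup>2)) * 1) {0..2 * pi}"
      using r by (intro poisson_integral_formula) auto
    then have "((\<lambda>t. Re (1 / of_real ((norm (cis t - of_real r))\<^sup>2))) has_integral
           Re (of_real (2 * pi / (1 - (norm (of_real r :: complex))\<^sup>2)) * 1)) {0..2 * pi}"
      by (rule has_integral_Re)
    then have "((\<lambda>t. 1 / (norm (cis t - of_real r))\<^sup>2) has_integral 2 * pi / (1 - r\<^sup>2)) {0..2 * pi}"
      unfolding mult_1_right Re_complex_of_real Re_divide_of_real by simp
    from has_integral_mult_right[OF this, of c] have "(w has_integral 1) {0..2 * pi}"
      unfolding c' by (simp add: w_def c_def)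
    from nn_integral_has_integral_lebesgue'[OF _ this] w0
    have "(\<integral>\<^sup>+t\<in>{0..2 * pi}. ennreal (w t) \<partial>lborel) = ennreal 1" by simp
    then show ?thesis
      by (subst (asm) nn_integral_arc_0_2pi) (simp_all add: wper)
  qed
  have pt: "ennreal (norm (v (of_real r * cis \<theta>)) powr p)
      \<le> (\<integral>\<^sup>+t. ennreal (norm (F (\<theta> + t)) powr p * w t) \<partial>arc_measure)" for \<theta>
  proof -
    \<comment> \<open>Rotating the function instead of the point keeps the evaluation point at
      \<open>r\<close>, so one kernel \<open>w\<close> serves all \<theta>.\<close>
    let ?v = "\<lambda>z. v (z * cis \<theta>)"
    have "((\<lambda>t. ?v (cis t) / of_real ((norm (cis t - of_real r))\<^sup>2)) has_integral
           of_real (2 * pi / (1 - (norm (of_real r :: complex))\<^sup>2)) * ?v (of_real r)) {0..2 * pi}"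
    proof (rule poisson_integral_formula)
      show "continuous_on (cball 0 1) ?v"
        by (intro continuous_intros continuous_on_compose2[OF cont]) (auto simp: norm_mult)
      show "?v holomorphic_on ball 0 1"
        by (intro holomorphic_intros holomorphic_on_compose_gen[OF _ hol, unfolded o_def]) (auto simp: norm_mult)
    qed (use r in simp)
    then have "((\<lambda>t. of_real c * (?v (cis t) / of_real ((norm (cis t - of_real r))\<^sup>2))) has_integral
           of_real c * (of_real (2 * pi / (1 - (norm (of_real r :: complex))\<^sup>2)) * ?v (of_real r))) {0..2 * pi}"
      by (rule has_integral_mult_right)
    also have "of_real c * (of_real (2 * pi / (1 - (norm (of_real r :: complex))\<^sup>2)) * ?v (of_real r))
        = of_real (c * (2 * pi / (1 - r\<^sup>2))) * ?v (of_real r)" by simp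
    also have "\<dots> = ?v (of_real r)" unfolding c' by simp
    also have "(\<lambda>t. of_real c * (?v (cis t) / of_real ((norm (cis t - of_real r))\<^sup>2)))
        = (\<lambda>t. F (\<theta> + t) * of_real (w t))"
      by (auto simp: F_def w_def c_def cis_mult add.commute)
    finally have "ennreal (norm (?v (of_real r))) \<le> (\<integral>\<^sup>+t. ennreal (norm (F (\<theta> + t) * of_real (w t))) \<partial>arc_measure)"
    proof (rule norm_has_integral_le_nn_integral_arc)
      show "continuous_on UNIV (\<lambda>t. F (\<theta> + t) * of_real (w t))"
        by (intro continuous_on_mult continuous_on_of_real wcont continuous_on_compose2[OF Fc])
          (auto intro!: continuous_intros)
      show "F (\<theta> + (x + 2 * pi)) * of_real (w (x + 2 * pi)) = F (\<theta> + x) * of_real (w x)" for x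
        by (simp add: F_def wper flip: add.assoc)
    qed
    also have "\<dots> = (\<integral>\<^sup>+t. ennreal (norm (F (\<theta> + t)) * w t) \<partial>arc_measure)"
      by (simp add: norm_mult w0)
    finally have "ennreal (norm (?v (of_real r)) powr p)
      \<le> ennreal (1 powr (p - 1)) * (\<integral>\<^sup>+t. ennreal (norm (F (\<theta> + t)) powr p * w t) \<partial>arc_measure)"
      by (intro nn_integral_powr_le w0 p w1) auto
    then show ?thesis by simp
  qed
  have "(\<integral>\<^sup>+\<theta>. ennreal (norm (v (of_real r * cis \<theta>)) powr p) \<partial>arc_measure)
      \<le> (\<integral>\<^sup>+\<theta>. (\<integral>\<^sup>+t. ennreal (norm (F (\<theta> + t)) powr p * w t) \<partial>arc_measure) \<partial>arc_measure)"
    by (intro nn_integral_mono pt)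
  also have "\<dots> = (\<integral>\<^sup>+t. (\<integral>\<^sup>+\<theta>. ennreal (norm (F (\<theta> + t)) powr p * w t) \<partial>arc_measure) \<partial>arc_measure)"
    by (rule arc_pair.Fubini') measurable
  also have "\<dots> = (\<integral>\<^sup>+t. (\<integral>\<^sup>+\<theta>. ennreal (norm (F (\<theta> + t)) powr p) \<partial>arc_measure) * ennreal (w t) \<partial>arc_measure)"
    by (subst nn_integral_multc[symmetric]) (auto simp: ennreal_mult w0)
  also have "\<dots> = (\<integral>\<^sup>+t. (\<integral>\<^sup>+\<theta>. ennreal (norm (F \<theta>) powr p) \<partial>arc_measure) * ennreal (w t) \<partial>arc_measure)"
    by (intro nn_integral_cong arg_cong2[where f = "(*)"] refl nn_integral_arc_rotate) (auto simp: F_def)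
  also have "\<dots> = (\<integral>\<^sup>+\<theta>. ennreal (norm (F \<theta>) powr p) \<partial>arc_measure)"
    by (subst nn_integral_cmult) (auto simp: w1)
  finally show ?thesis by (simp add: F_def)
qed

text \<open>Subtracting the boundary value \<open>v (cis \<theta>)\<close> leaves the derivative
  unchanged, but puts a difference of boundary values into Cauchy's formula. The factor
  \<open>cis \<theta>\<close> from rotating to the real point \<open>r\<close> has modulus
  1.\<close>

lemma norm_deriv_le_nn_integral_arc:
  assumes cont: "continuous_on (cball 0 1) v" and hol: "v holomorphic_on ball 0 1"
    and r: "0 \<le> r" "r < 1"
  shows "ennreal (norm (deriv v (of_real r * cis \<theta>)))
    \<le> (\<integral>\<^sup>+t. ennreal (norm (v (cis (\<theta> + t)) - v (cis \<theta>)) / (2 * pi) / (norm (cis t - of_real r))\<^sup>2) \<partial>arc_measure)"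
proof -
  let ?v = "\<lambda>z. v (z * cis \<theta>) - v (cis \<theta>)"
  have d: "cis t \<noteq> of_real r" for t using norm_cis_diff_pos[of "of_real r" t] r by auto
  have contv: "continuous_on (cball 0 1) ?v"
    by (intro continuous_intros continuous_on_compose2[OF cont]) (auto simp: norm_mult)
  have holv: "?v holomorphic_on ball 0 1"
    by (intro holomorphic_intros holomorphic_on_compose_gen[OF _ hol, unfolded o_def]) (auto simp: norm_mult)
  have rb: "of_real r \<in> ball (0::complex) 1" using r by simp
  note C = Cauchy_derivative_integral_circlepath[OF contv holv rb]
  have "(v has_field_derivative deriv v (of_real r * cis \<theta>)) (at (of_real r * cis \<theta>))"
    using r by (intro holomorphic_derivI[OF hol]) (auto simp: norm_mult)
  then have "(?v has_field_derivative deriv v (of_real r * cis \<theta>) * cis \<theta>) (at (of_real r))"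
    by (auto intro!: derivative_eq_intros DERIV_chain2[of v _ "\<lambda>z. z * cis \<theta>"])
  from DERIV_unique[OF this C(2)]
  have eq: "deriv v (of_real r * cis \<theta>) * cis \<theta> = 1 / (2 * of_real pi * \<i>) *
     contour_integral (circlepath 0 1) (\<lambda>u. ?v u / (u - of_real r)\<^sup>2)" .
  have *: "((\<lambda>t. ?v (0 + of_real 1 * cis t) / ((0 + of_real 1 * cis t) - of_real r)\<^sup>2 * of_real 1 * \<i> * cis t)
       has_integral contour_integral (circlepath 0 1) (\<lambda>u. ?v u / (u - of_real r)\<^sup>2)) {0..2 * pi}"
    using has_contour_integral_integral[OF C(1)]
    unfolding circlepath_def by (subst (asm) has_contour_integral_part_circlepath_iff) auto
  let ?g = "\<lambda>t. 1 / (2 * of_real pi * \<i>) * ((v (cis (\<theta> + t)) - v (cis \<theta>)) / (cis t - of_real r)\<^sup>2 * \<i> * cis t)"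
  have "(?g has_integral deriv v (of_real r * cis \<theta>) * cis \<theta>) {0..2 * pi}"
    using has_integral_mult_right[OF *, of "1 / (2 * of_real pi * \<i>)"]
    unfolding eq by (simp add: cis_mult add.commute)
  then have "ennreal (norm (deriv v (of_real r * cis \<theta>) * cis \<theta>)) \<le> (\<integral>\<^sup>+t. ennreal (norm (?g t)) \<partial>arc_measure)"
  proof (rule norm_has_integral_le_nn_integral_arc)
    have "continuous_on UNIV (\<lambda>t. v (cis t))"
      by (intro continuous_on_cis_compose continuous_on_subset[OF cont]) auto
    then show "continuous_on UNIV ?g"
      using d by (intro continuous_on_mult continuous_on_diff continuous_on_divide
          continuous_on_compose2[of UNIV "\<lambda>t. v (cis t)" UNIV "\<lambda>t. \<theta> + t"])
          (auto intro!: continuous_intros)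
    show "?g (x + 2 * pi) = ?g x" for x by (simp flip: add.assoc)
  qed
  also have "(\<lambda>t. ennreal (norm (?g t)))
    = (\<lambda>t. ennreal (norm (v (cis (\<theta> + t)) - v (cis \<theta>)) / (2 * pi) / (norm (cis t - of_real r))\<^sup>2))"
    by (simp add: norm_mult norm_divide norm_power mult_ac)
  finally show ?thesis by (simp add: norm_mult)
qed

subsection \<open>The kernel estimate\<close>

lemma norm_cis_minus_1: "norm (cis t - 1) = 2 * \<bar>sin (t / 2)\<bar>"
proof -
  have "(norm (cis t - 1))\<^sup>2 = (cos t - 1)\<^sup>2 + (sin t)\<^sup>2"
    by (simp add: cmod_power2)
  also have "\<dots> = 2 - 2 * cos t"
    using sin_cos_squared_add[of t] by (simp add: power2_diff)
  also have "\<dots> = (2 * \<bar>sin (t / 2)\<bar>)\<^sup>2"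
    using cos_double_sin[of "t / 2"] by (simp add: power_mult_distrib)
  finally show ?thesis by (rule power2_eq_imp_eq) auto
qed

lemma norm_cis_minus_1_le: "norm (cis t - 1) \<le> \<bar>t\<bar>"
  using abs_sin_x_le_abs_x[of "t / 2"] by (simp add: norm_cis_minus_1)

text \<open>The function \<open>sin y - y * cos y\<close> vanishes at 0 and has derivative
  \<open>y * sin y\<close>.\<close>

lemma mult_cos_le_sin:
  assumes "0 \<le> y" "y \<le> pi"
  shows "y * cos y \<le> sin y"
proof -
  have "(\<lambda>y. sin y - y * cos y) 0 \<le> (\<lambda>y. sin y - y * cos y) y"
  proof (rule DERIV_nonneg_imp_nondecreasing[OF assms(1)])
    fix x assume "0 \<le> x" "x \<le> y"
    then show "\<exists>D. ((\<lambda>y. sin y - y * cos y) has_real_derivative D) (at x) \<and> 0 \<le> D"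
      using assms by (intro exI[of _ "x * sin x"]) (auto intro!: derivative_eq_intros sin_ge_zero mult_nonneg_nonneg)
  qed
  then show ?thesis by simp
qed

text \<open>A weak form of Jordan's inequality: by the previous bound at \<open>x / 2\<close> and
  the double angle formulas, \<open>sin x\<close> is at least
  \<open>x * (1 + cos x) / 2\<close>.\<close>

lemma half_le_sin:
  assumes "0 \<le> x" "x \<le> pi / 2"
  shows "x / 2 \<le> sin x"
proof -
  have "x / 2 * cos (x / 2) \<le> sin (x / 2)"
    using assms by (intro mult_cos_le_sin) auto
  then have "x / 2 * cos (x / 2) * (2 * cos (x / 2)) \<le> sin (x / 2) * (2 * cos (x / 2))"
    using assms by (intro mult_right_mono mult_nonneg_nonneg cos_ge_zero) auto
  also have "\<dots> = sin x" using sin_double[of "x / 2"] by simp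
  finally have "x * (cos (x / 2))\<^sup>2 \<le> sin x" by (simp add: power2_eq_square algebra_simps)
  moreover have "(cos (x / 2))\<^sup>2 = (1 + cos x) / 2"
    using cos_double_cos[of "x / 2"] by simp
  moreover have "0 \<le> x * cos x" using assms by (intro mult_nonneg_nonneg cos_ge_zero) auto
  ultimately show ?thesis by (simp add: field_simps)
qed

text \<open>Together with the upper bound this makes chord and arc comparable on one period, so that
  powers of the chord can be replaced by powers of \<open>\<bar>t\<bar>\<close>.\<close>

lemma le_norm_cis_minus_1:
  assumes "\<bar>t\<bar> \<le> pi"
  shows "\<bar>t\<bar> / 2 \<le> norm (cis t - 1)"
proof -
  have "\<bar>t\<bar> / 4 \<le> sin (\<bar>t\<bar> / 2)" using half_le_sin[of "\<bar>t\<bar> / 2"] assms by simp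
  also have "\<dots> \<le> \<bar>sin (t / 2)\<bar>" by (cases "t \<ge> 0") (auto simp: sin_minus)
  finally show ?thesis by (simp add: norm_cis_minus_1)
qed

text \<open>Up to a factor 3, the distance from \<open>cis t\<close> to \<open>r\<close> is at least
  \<open>1 - r + d\<close>, with \<open>d\<close> the chord from 1 to \<open>cis t\<close>; the
  resulting majorant has an explicit antiderivative.\<close>

lemma nn_integral_radial_kernel_le:
  assumes d: "cis t \<noteq> 1"
  shows "(\<integral>\<^sup>+r\<in>{0..<1}. ennreal (1 / (norm (cis t - of_real r))\<^sup>2) \<partial>lborel) \<le> ennreal (9 / norm (cis t - 1))"
proof -
  define d where "d = norm (cis t - 1)"
  have d: "0 < d" using assms by (simp add: d_def)
  have "(\<integral>\<^sup>+r\<in>{0..<1}. ennreal (1 / (norm (cis t - of_real r))\<^sup>2) \<partial>lborel)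
      \<le> (\<integral>\<^sup>+r\<in>{0..1}. ennreal (9 / (1 - r + d)\<^sup>2) \<partial>lborel)"
  proof (intro nn_integral_mono)
    fix r :: real
    \<comment> \<open>The distance is at least \<open>1 - r\<close>, and by the triangle inequality
      through \<open>r\<close> twice the distance is at least \<open>d\<close>; the two bounds are
      added.\<close>
    have "(1 - r + d) / 3 \<le> norm (cis t - of_real r)" if "0 \<le> r" "r \<le> 1"
    proof -
      have "norm (cis t) - norm (of_real r :: complex) \<le> norm (cis t - of_real r)"
        by (rule norm_triangle_ineq2)
      moreover have "d \<le> norm (cis t - of_real r) + norm (of_real r - 1 :: complex)"
        unfolding d_def by (rule order_trans[OF _ norm_triangle_ineq]) simp
      moreover have "norm (of_real r - 1 :: complex) = 1 - r"
        using that by (metis norm_minus_commute norm_of_real of_real_1 of_real_diff abs_of_nonneg diff_ge_0_iff_ge)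
      ultimately show ?thesis using that by simp
    qed
    then have "1 / (norm (cis t - of_real r))\<^sup>2 \<le> 1 / ((1 - r + d) / 3)\<^sup>2" if "0 \<le> r" "r \<le> 1"
      using that d by (intro divide_left_mono power_mono mult_pos_pos zero_less_power)
         (auto intro: order_less_le_trans[of 0 "(1 - r + d) / 3"])
    then show "ennreal (1 / (norm (cis t - of_real r))\<^sup>2) * indicator {0..<1} r
      \<le> ennreal (9 / (1 - r + d)\<^sup>2) * indicator {0..1} r"
      by (auto simp: indicator_def power_divide intro!: ennreal_leI)
  qed
  also have "\<dots> = ennreal (9 / (1 - 1 + d) - 9 / (1 - 0 + d))"
  proof (rule nn_integral_FTC_Icc)
    fix x :: real assume "x \<in> {0..1}"
    then show "((\<lambda>r. 9 / (1 - r + d)) has_real_derivative 9 / (1 - x + d)\<^sup>2) (at x)"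
      using d by (auto intro!: derivative_eq_intros simp: power2_eq_square)
  qed auto
  also have "\<dots> \<le> ennreal (9 / d)" using d by (intro ennreal_leI) auto
  finally show ?thesis by (simp add: d_def)
qed

lemma nn_integral_abs_powr_finite:
  fixes \<alpha> :: real
  assumes "-1 < \<alpha>"
  shows "(\<integral>\<^sup>+t. ennreal (\<bar>t\<bar> powr \<alpha>) \<partial>arc_measure) < \<infinity>"
proof -
  have pos: "(\<integral>\<^sup>+t\<in>{0..pi}. ennreal (t powr \<alpha>) \<partial>lborel) = ennreal (pi powr (\<alpha> + 1) / (\<alpha> + 1))"
    using assms by (intro nn_integral_has_integral_lebesgue' has_integral_powr_from_0) auto
  have "(\<integral>\<^sup>+t\<in>{0..pi}. ennreal (t powr \<alpha>) \<partial>lborel)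
      = (\<integral>\<^sup>+t. ennreal ((0 + -1 * t) powr \<alpha>) * indicator {0..pi} (0 + -1 * t) \<partial>lborel)"
    by (subst nn_integral_real_affine[where c = "-1" and t = 0]) auto
  also have "\<dots> = (\<integral>\<^sup>+t\<in>{-pi..0}. ennreal ((-t) powr \<alpha>) \<partial>lborel)"
    by (intro nn_integral_cong) (auto simp: indicator_def)
  finally have neg: "(\<integral>\<^sup>+t\<in>{-pi..0}. ennreal ((-t) powr \<alpha>) \<partial>lborel) = ennreal (pi powr (\<alpha> + 1) / (\<alpha> + 1))"
    using pos by simp
  have "(\<integral>\<^sup>+t. ennreal (\<bar>t\<bar> powr \<alpha>) \<partial>arc_measure)
      \<le> (\<integral>\<^sup>+t. ennreal (t powr \<alpha>) * indicator {0..pi} t + ennreal ((-t) powr \<alpha>) * indicator {-pi..0} t \<partial>lborel)"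
    by (subst nn_integral_arc) (auto intro!: nn_integral_mono simp: indicator_def)
  also have "\<dots> < \<infinity>"
    by (subst nn_integral_add) (auto simp: pos neg)
  finally show ?thesis .
qed

text \<open>Integrating the derivative bound over the radius and applying Fubini leaves the kernel
  \<open>1 / \<bar>t\<bar>\<close>, to which Jensen is applied. \<open>K\<close> is chosen before
  \<open>v\<close> and \<theta>, so it serves all dilates and all angles.\<close>

lemma radial_variation_powr_le:
  assumes s: "0 < s" and p: "1 < p"
  shows "\<exists>K\<ge>0. \<forall>v \<theta> x. continuous_on (cball 0 1) v \<longrightarrow> v holomorphic_on ball 0 1 \<longrightarrow> 0 \<le> x \<longrightarrow>
     ennreal x \<le> (\<integral>\<^sup>+r\<in>{0..<1}. ennreal (norm (deriv v (of_real r * cis \<theta>))) \<partial>lborel) \<longrightarrow>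
     ennreal (x powr p) \<le> ennreal K *
       (\<integral>\<^sup>+t. ennreal (norm (v (cis (\<theta> + t)) - v (cis \<theta>)) powr p / norm (cis t - 1) powr (1 + s * p)) \<partial>arc_measure)"
proof -
  \<comment> \<open>With this exponent, Jensen's inequality for the weight \<open>\<bar>t\<bar> powr \<alpha>\<close> turns the kernel \<open>1 / \<bar>t\<bar>\<close>
    into \<open>1 / \<bar>t\<bar> powr (1 + s * p)\<close>.\<close>
  define \<alpha> where "\<alpha> = s * p / (p - 1) - 1"
  have \<alpha>: "\<alpha> * (p - 1) = s * p - (p - 1)"
    using p by (simp add: \<alpha>_def left_diff_distrib)
  have "-1 < \<alpha>" using s p by (simp add: \<alpha>_def)
  from nn_integral_abs_powr_finite[OF this]
  obtain W where W: "0 \<le> W" "(\<integral>\<^sup>+t. ennreal (\<bar>t\<bar> powr \<alpha>) \<partial>arc_measure) = ennreal W"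
    by (metis ennreal_cases infinity_ennreal_def less_irrefl)
  show ?thesis
  \<comment> \<open>\<open>W powr (p - 1)\<close> is the constant in Jensen's inequality;
    \<open>3 powr p\<close> appears because that inequality is applied to
    \<open>x / 3\<close>.\<close>
  proof (intro exI[of _ "3 powr p * W powr (p - 1)"] conjI allI impI)
    fix v :: "complex \<Rightarrow> complex" and \<theta> x :: real
    assume cont: "continuous_on (cball 0 1) v" and hol: "v holomorphic_on ball 0 1" and x0: "0 \<le> x"
      and x: "ennreal x \<le> (\<integral>\<^sup>+r\<in>{0..<1}. ennreal (norm (deriv v (of_real r * cis \<theta>))) \<partial>lborel)"
    define D where "D = (\<lambda>t. norm (v (cis (\<theta> + t)) - v (cis \<theta>)))"
    have "continuous_on UNIV (\<lambda>t. v (cis t))"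
      by (intro continuous_on_cis_compose continuous_on_subset[OF cont]) auto
    then have "continuous_on UNIV (\<lambda>t. v (cis (\<theta> + t)))"
      by (rule continuous_on_compose2) (auto intro!: continuous_intros)
    then have [measurable]: "D \<in> borel_measurable borel"
      unfolding D_def by (intro borel_measurable_continuous_onI continuous_intros)
    interpret P: pair_sigma_finite arc_measure "lborel :: real measure" ..
    have D0: "0 \<le> D t" for t by (simp add: D_def)
    \<comment> \<open>At points with \<open>cis t = 1\<close> the kernel is singular, but the
      difference vanishes and both sides of the estimates below are 0.\<close>
    have Dz: "D t = 0" if "cis t = 1" for t
      using that by (simp add: D_def cis_mult[symmetric])
    have third: "ennreal (1 / 3) * ennreal 3 = 1"
      by (subst ennreal_mult'[symmetric]) auto
    have "ennreal x \<le> (\<integral>\<^sup>+r\<in>{0..<1}. ennreal (norm (deriv v (of_real r * cis \<theta>))) \<partial>lborel)"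
      by (rule x)
    also have "\<dots> \<le> (\<integral>\<^sup>+r. (\<integral>\<^sup>+t. ennreal (D t / (2 * pi) / (norm (cis t - of_real r))\<^sup>2) * indicator {0..<1} r
          \<partial>arc_measure) \<partial>lborel)"
    proof (rule nn_integral_mono)
      fix r :: real
      show "ennreal (norm (deriv v (of_real r * cis \<theta>))) * indicator {0..<1} r
        \<le> (\<integral>\<^sup>+t. ennreal (D t / (2 * pi) / (norm (cis t - of_real r))\<^sup>2) * indicator {0..<1} r \<partial>arc_measure)"
        using norm_deriv_le_nn_integral_arc[OF cont hol, of r \<theta>] by (auto simp: indicator_def D_def)
    qed
    also have "\<dots> = (\<integral>\<^sup>+t. (\<integral>\<^sup>+r. ennreal (D t / (2 * pi) / (norm (cis t - of_real r))\<^sup>2) * indicator {0..<1} r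
          \<partial>lborel) \<partial>arc_measure)"
      by (rule P.Fubini') measurable
    also have "\<dots> \<le> (\<integral>\<^sup>+t. ennreal 3 * ennreal (D t * \<bar>t\<bar> powr (-1 - \<alpha>) * \<bar>t\<bar> powr \<alpha>) \<partial>arc_measure)"
    \<comment> \<open>The lower bound for the chord holds only for
      \<open>\<bar>t\<bar> \<le> pi\<close>, so the comparison is made almost everywhere for
      \<open>arc_measure\<close>.\<close>
    proof (rule nn_integral_mono_AE)
      have le: "(\<integral>\<^sup>+r. ennreal (D t / (2 * pi) / (norm (cis t - of_real r))\<^sup>2) * indicator {0..<1} r \<partial>lborel)
        \<le> ennreal 3 * ennreal (D t * \<bar>t\<bar> powr (-1 - \<alpha>) * \<bar>t\<bar> powr \<alpha>)" if t: "t \<in> {-pi..pi}" for t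
      proof (cases "cis t = 1")
        case True
        then show ?thesis by (simp add: Dz)
      next
        case False
        then have t0: "t \<noteq> 0" by auto
        have "(\<integral>\<^sup>+r. ennreal (D t / (2 * pi) / (norm (cis t - of_real r))\<^sup>2) * indicator {0..<1} r \<partial>lborel)
          = ennreal (D t / (2 * pi)) * (\<integral>\<^sup>+r\<in>{0..<1}. ennreal (1 / (norm (cis t - of_real r))\<^sup>2) \<partial>lborel)"
          by (subst nn_integral_cmult[symmetric])
            (auto intro!: nn_integral_cong simp: D0 mult.assoc[symmetric] ennreal_mult'[symmetric])
        also have "\<dots> \<le> ennreal (D t / (2 * pi)) * ennreal (9 / norm (cis t - 1))"
          by (intro mult_left_mono nn_integral_radial_kernel_le False) auto
        also have "\<dots> = ennreal (D t * (9 / (2 * pi) / norm (cis t - 1)))"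
          by (subst ennreal_mult'[symmetric]) (auto simp: D0)
        also have "\<dots> \<le> ennreal (3 * (D t * (1 / \<bar>t\<bar>)))"
        proof (rule ennreal_leI)
          have "9 / (2 * pi) / norm (cis t - 1) \<le> (3 / 2) / (\<bar>t\<bar> / 2)"
          proof (rule frac_le)
            show "9 / (2 * pi) \<le> 3 / 2" using pi_gt3 by (simp add: field_simps)
            show "\<bar>t\<bar> / 2 \<le> norm (cis t - 1)" using t by (intro le_norm_cis_minus_1) auto
          qed (use t0 in auto)
          then have "D t * (9 / (2 * pi) / norm (cis t - 1)) \<le> D t * (3 * (1 / \<bar>t\<bar>))"
            by (intro mult_left_mono D0) simp
          then show "D t * (9 / (2 * pi) / norm (cis t - 1)) \<le> 3 * (D t * (1 / \<bar>t\<bar>))" by simp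
        qed
        \<comment> \<open>The second factor is the weight for Jensen's inequality, the first goes
          with \<open>D t\<close> under the \<open>p\<close>-th power.\<close>
        also have "1 / \<bar>t\<bar> = \<bar>t\<bar> powr (-1 - \<alpha>) * \<bar>t\<bar> powr \<alpha>"
          using t0 by (simp add: powr_add[symmetric] powr_minus_divide)
        finally show ?thesis by (simp add: ennreal_mult' mult.assoc)
      qed
      show "AE t in arc_measure. (\<integral>\<^sup>+r. ennreal (D t / (2 * pi) / (norm (cis t - of_real r))\<^sup>2) * indicator {0..<1} r \<partial>lborel)
        \<le> ennreal 3 * ennreal (D t * \<bar>t\<bar> powr (-1 - \<alpha>) * \<bar>t\<bar> powr \<alpha>)"
        by (intro AE_arc_measureI le) auto
    qed
    also have "\<dots> = ennreal 3 * (\<integral>\<^sup>+t. ennreal (D t * \<bar>t\<bar> powr (-1 - \<alpha>) * \<bar>t\<bar> powr \<alpha>) \<partial>arc_measure)"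
      by (rule nn_integral_cmult) measurable
    finally have "ennreal (1 / 3) * ennreal x
      \<le> ennreal (1 / 3) * (ennreal 3 * (\<integral>\<^sup>+t. ennreal (D t * \<bar>t\<bar> powr (-1 - \<alpha>) * \<bar>t\<bar> powr \<alpha>) \<partial>arc_measure))"
      by (rule mult_left_mono) simp
    then have "ennreal (x / 3) \<le> (\<integral>\<^sup>+t. ennreal (D t * \<bar>t\<bar> powr (-1 - \<alpha>) * \<bar>t\<bar> powr \<alpha>) \<partial>arc_measure)"
      unfolding mult.assoc[symmetric] third by (simp add: ennreal_mult'[symmetric])
    then have "ennreal ((x / 3) powr p) \<le> ennreal (W powr (p - 1)) *
        (\<integral>\<^sup>+t. ennreal ((D t * \<bar>t\<bar> powr (-1 - \<alpha>)) powr p * \<bar>t\<bar> powr \<alpha>) \<partial>arc_measure)"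
      using x0 by (intro nn_integral_powr_le p W) (auto simp: D0)
    also have "\<dots> \<le> ennreal (W powr (p - 1)) *
        (\<integral>\<^sup>+t. ennreal (D t powr p / norm (cis t - 1) powr (1 + s * p)) \<partial>arc_measure)"
    proof (intro mult_left_mono nn_integral_mono ennreal_leI)
      fix t :: real
      show "(D t * \<bar>t\<bar> powr (-1 - \<alpha>)) powr p * \<bar>t\<bar> powr \<alpha> \<le> D t powr p / norm (cis t - 1) powr (1 + s * p)"
      proof (cases "cis t = 1")
        case True
        then show ?thesis by (simp add: Dz)
      next
        case False
        then have t0: "t \<noteq> 0" by auto
        have "(-1 - \<alpha>) * p + \<alpha> = - (1 + s * p)"
          using \<alpha> by (simp add: algebra_simps)
        then have "(D t * \<bar>t\<bar> powr (-1 - \<alpha>)) powr p * \<bar>t\<bar> powr \<alpha> = D t powr p * \<bar>t\<bar> powr (- (1 + s * p))"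
          by (simp add: powr_mult D0 powr_powr powr_add[symmetric] mult.assoc)
        also have "\<dots> = D t powr p / \<bar>t\<bar> powr (1 + s * p)"
          by (simp only: powr_minus_divide times_divide_eq_right mult_1_right)
        also have "\<dots> \<le> D t powr p / norm (cis t - 1) powr (1 + s * p)"
          using False t0 s p by (intro divide_left_mono powr_mono2 norm_cis_minus_1_le) auto
        finally show ?thesis .
      qed
    qed auto
    finally have "ennreal (3 powr p) * ennreal ((x / 3) powr p) \<le> ennreal (3 powr p) * (ennreal (W powr (p - 1)) *
        (\<integral>\<^sup>+t. ennreal (D t powr p / norm (cis t - 1) powr (1 + s * p)) \<partial>arc_measure))"
      by (rule mult_left_mono) simp
    moreover have "3 powr p * (x / 3) powr p = x powr p"
      using x0 by (simp add: powr_divide)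
    ultimately show "ennreal (x powr p) \<le> ennreal (3 powr p * W powr (p - 1)) *
       (\<integral>\<^sup>+t. ennreal (norm (v (cis (\<theta> + t)) - v (cis \<theta>)) powr p / norm (cis t - 1) powr (1 + s * p)) \<partial>arc_measure)"
      by (simp add: D_def ennreal_mult'[symmetric] mult.assoc[symmetric])
  qed auto
qed

subsection \<open>The Gagliardo integral\<close>

text \<open>The \<open>p\<close>-th power of the seminorm, for a function of the angle, in the
  variables \<theta> and \<open>t = \<xi> - \<theta>\<close>: the kernel then depends on
  \<open>t\<close> alone.\<close>

definition gagliardo_integral :: "real \<Rightarrow> real \<Rightarrow> (real \<Rightarrow> complex) \<Rightarrow> ennreal" where
  "gagliardo_integral s p F =
     (\<integral>\<^sup>+\<theta>. (\<integral>\<^sup>+t. ennreal (norm (F (\<theta> + t) - F \<theta>) powr p / norm (cis t - 1) powr (1 + s * p))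
        \<partial>arc_measure) \<partial>arc_measure)"

text \<open>The inner variable is rotated by \<sigma>; rotation preserves chords. Borel
  measurability allows \<open>lebesgue\<close> to be replaced by \<open>lborel\<close>.\<close>

lemma gagliardo_seminorm_eq:
  assumes [measurable]: "(\<lambda>t. f (cis t)) \<in> borel_measurable borel"
  shows "gagliardo_seminorm s p f = ennreal_powr (gagliardo_integral s p (\<lambda>t. f (cis t))) (1 / p)"
proof -
  define F where "F = (\<lambda>t. f (cis t))"
  have [measurable]: "F \<in> borel_measurable borel" by (simp add: F_def)
  let ?k = "\<lambda>\<xi> \<sigma>. ennreal (norm (F \<xi> - F \<sigma>) powr p / norm (cis \<xi> - cis \<sigma>) powr (1 + s * p))"
  have "(\<integral>\<^sup>+\<xi>\<in>{-pi..pi}. ?k \<xi> \<sigma> \<partial>lebesgue)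
      = (\<integral>\<^sup>+t. ennreal (norm (F (\<sigma> + t) - F \<sigma>) powr p / norm (cis t - 1) powr (1 + s * p)) \<partial>arc_measure)"
    (is "?l = ?r \<sigma>") for \<sigma>
  proof -
    have "?l = (\<integral>\<^sup>+\<xi>. ?k \<xi> \<sigma> \<partial>arc_measure)"
      by (simp add: nn_integral_completion nn_integral_arc)
    also have "\<dots> = (\<integral>\<^sup>+t. ?k (t + \<sigma>) \<sigma> \<partial>arc_measure)"
      by (rule nn_integral_arc_rotate[symmetric]) (auto simp: F_def)
    also have "\<dots> = ?r \<sigma>"
    proof (intro nn_integral_cong)
      fix t
      have "cis (\<sigma> + t) - cis \<sigma> = (cis t - 1) * cis \<sigma>" by (simp add: algebra_simps cis_mult)
      then have "norm (cis (\<sigma> + t) - cis \<sigma>) = norm (cis t - 1)" by (simp add: norm_mult)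
      then show "?k (t + \<sigma>) \<sigma> = ennreal (norm (F (\<sigma> + t) - F \<sigma>) powr p / norm (cis t - 1) powr (1 + s * p))"
        by (simp add: add.commute[of t])
    qed
    finally show ?thesis .
  qed
  then have "(\<integral>\<^sup>+\<sigma>\<in>{-pi..pi}. (\<integral>\<^sup>+\<xi>\<in>{-pi..pi}. ?k \<xi> \<sigma> \<partial>lebesgue) \<partial>lebesgue)
      = (\<integral>\<^sup>+\<sigma>\<in>{-pi..pi}. ?r \<sigma> \<partial>lborel)"
    by (simp add: nn_integral_completion)
  also have "\<dots> = gagliardo_integral s p F"
    unfolding gagliardo_integral_def by (subst nn_integral_arc) auto
  finally show ?thesis
    by (simp add: gagliardo_seminorm_def F_def)
qed

text \<open>Exposes the \<open>p\<close>-th power of the \<open>L^p\<close> distance between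
  \<open>F\<close> and its translate by \<open>t\<close>, so that limits can be taken first for
  fixed \<open>t\<close> and then under the integral over \<open>t\<close>.\<close>

lemma gagliardo_integral_swap:
  assumes [measurable]: "F \<in> borel_measurable borel"
  shows "gagliardo_integral s p F =
    (\<integral>\<^sup>+t. (\<integral>\<^sup>+\<theta>. ennreal (norm (F (\<theta> + t) - F \<theta>) powr p) \<partial>arc_measure)
       * ennreal (1 / norm (cis t - 1) powr (1 + s * p)) \<partial>arc_measure)"
proof -
  have "gagliardo_integral s p F = (\<integral>\<^sup>+t. (\<integral>\<^sup>+\<theta>. ennreal (norm (F (\<theta> + t) - F \<theta>) powr p / norm (cis t - 1) powr (1 + s * p))
        \<partial>arc_measure) \<partial>arc_measure)"
    unfolding gagliardo_integral_def by (rule arc_pair.Fubini') measurable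
  also have "\<dots> = (\<integral>\<^sup>+t. (\<integral>\<^sup>+\<theta>. ennreal (norm (F (\<theta> + t) - F \<theta>) powr p) \<partial>arc_measure)
       * ennreal (1 / norm (cis t - 1) powr (1 + s * p)) \<partial>arc_measure)"
    by (subst nn_integral_multc[symmetric]) (auto simp: ennreal_mult[symmetric])
  finally show ?thesis .
qed

section \<open>Norms and powers in the extended half-line\<close>

lemma Lp_norm_circle_eq:
  assumes [measurable]: "(\<lambda>t. f (cis t)) \<in> borel_measurable borel"
  shows "Lp_norm_circle p f = ennreal_powr (\<integral>\<^sup>+t. ennreal (norm (f (cis t)) powr p) \<partial>arc_measure) (1 / p)"
  by (simp add: Lp_norm_circle_def nn_integral_completion nn_integral_arc)

lemma ennreal_powr_less_top_iff [simp]: "ennreal_powr x a < top \<longleftrightarrow> x < top"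
  by (auto simp: ennreal_powr_def less_top)

lemma ennreal_powr_mono:
  assumes "x \<le> y" "0 \<le> a"
  shows "ennreal_powr x a \<le> ennreal_powr y a"
proof (cases "y = \<infinity>")
  case False
  then have "y < top" "x < top" using assms by (auto simp: less_top top_unique)
  then show ?thesis
    using assms by (auto simp: ennreal_powr_def intro!: ennreal_leI powr_mono2 enn2real_mono)
qed (simp add: ennreal_powr_def)

lemma le_of_ennreal_powr_le:
  assumes "ennreal_powr x (1 / p) \<le> S" "S < \<infinity>" "0 < p"
  shows "x \<le> ennreal (enn2real S powr p)"
proof -
  have "x < \<infinity>" using order_le_less_trans[OF assms(1,2)] by simp
  then have x: "x = ennreal (enn2real x)" by (simp add: less_top)
  have "ennreal (enn2real x powr (1 / p)) \<le> ennreal (enn2real S)"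
    using assms \<open>x < \<infinity>\<close> by (simp add: ennreal_powr_def less_top split: if_splits)
  then have "enn2real x powr (1 / p) \<le> enn2real S" by simp
  then have "(enn2real x powr (1 / p)) powr p \<le> enn2real S powr p"
    using assms by (intro powr_mono2) auto
  then have "enn2real x \<le> enn2real S powr p" using assms by (simp add: powr_powr)
  then show ?thesis by (subst x) (rule ennreal_leI)
qed

text \<open>Near a finite limit the values are eventually finite, where \<open>ennreal_powr\<close>
  is the real power; positivity of \<open>a\<close> gives continuity at 0.\<close>

lemma tendsto_ennreal_powr:
  assumes f: "(f \<longlongrightarrow> x) F" and x: "x < \<infinity>" and a: "0 < a"
  shows "((\<lambda>n. ennreal_powr (f n) a) \<longlongrightarrow> ennreal_powr x a) F"
proof -
  have "((\<lambda>n. ennreal (enn2real (f n) powr a)) \<longlongrightarrow> ennreal (enn2real x powr a)) F"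
  proof (intro tendsto_ennrealI tendsto_powr' tendsto_const)
    show "((\<lambda>n. enn2real (f n)) \<longlongrightarrow> enn2real x) F"
      using f x by (intro tendsto_enn2real) auto
  qed (use a in auto)
  moreover have "\<forall>\<^sub>F n in F. ennreal (enn2real (f n) powr a) = ennreal_powr (f n) a"
    using order_tendstoD(2)[OF f x] by eventually_elim (auto simp: ennreal_powr_def)
  ultimately have "((\<lambda>n. ennreal_powr (f n) a) \<longlongrightarrow> ennreal (enn2real x powr a)) F"
    by (rule Lim_transform_eventually)
  moreover have "ennreal_powr x a = ennreal (enn2real x powr a)"
    using x by (auto simp: ennreal_powr_def)
  ultimately show ?thesis by simp
qed

section \<open>Variation along radii and radial limits\<close>

text \<open>The length of the image under \<open>u\<close> of the radius at angle \<theta>, up to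
  radius \<rho>. It may be infinite at \<rho> = 1.\<close>

definition radial_variation :: "(complex \<Rightarrow> complex) \<Rightarrow> real \<Rightarrow> real \<Rightarrow> ennreal" where
  "radial_variation u \<rho> \<theta> = (\<integral>\<^sup>+r\<in>{0..<\<rho>}. ennreal (norm (deriv u (of_real r * cis \<theta>))) \<partial>lborel)"

context
  fixes u :: "complex \<Rightarrow> complex"
  assumes hol: "u holomorphic_on ball 0 1"
begin

lemma dilate_borel: "(\<lambda>t. u (of_real r * cis t)) \<in> borel_measurable borel" if "\<bar>r\<bar> < 1"
  using that by (intro borel_measurable_continuous_onI
      continuous_on_compose2[OF holomorphic_on_imp_continuous_on[OF hol]])
    (auto intro!: continuous_intros simp: norm_mult)

lemma dilate_holomorphic: "dilate u r holomorphic_on ball 0 1" if "\<bar>r\<bar> \<le> 1"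
  unfolding dilate_def
proof (intro holomorphic_on_compose_gen[OF _ hol, unfolded o_def] holomorphic_intros)
  show "(\<lambda>z. of_real r * z) ` ball 0 1 \<subseteq> ball (0 :: complex) 1"
    using that by (auto simp: norm_mult intro!: order_le_less_trans[OF mult_left_le_one_le])
qed

lemma dilate_continuous: "continuous_on (cball 0 1) (dilate u r)" if "\<bar>r\<bar> < 1"
  unfolding dilate_def
proof (intro continuous_on_compose2[OF holomorphic_on_imp_continuous_on[OF hol]] continuous_intros)
  show "(\<lambda>z. of_real r * z) ` cball 0 1 \<subseteq> ball (0 :: complex) 1"
    using that by (auto simp: norm_mult intro!: order_le_less_trans[OF mult_right_le_one_le])
qed

lemma continuous_on_deriv: "continuous_on (ball 0 1) (deriv u)"
  by (intro holomorphic_on_imp_continuous_on holomorphic_deriv hol) auto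

text \<open>Measurability comes from continuity of \<open>deriv u\<close> inside the disc; the
  indicator hides its uncontrolled values outside.\<close>

lemma radial_deriv_borel [measurable]:
  "(\<lambda>x. ennreal (norm (deriv u (of_real (snd x) * cis (fst x)))) * indicator {0..<\<rho>} (snd x))
     \<in> borel_measurable (borel \<Otimes>\<^sub>M borel)" if "\<rho> \<le> 1"
proof -
  let ?S = "UNIV \<times> {0..<\<rho>} :: (real \<times> real) set"
  have "(\<lambda>x. indicator ?S x *\<^sub>R norm (deriv u (of_real (snd x) * cis (fst x)))) \<in> borel_measurable borel"
  proof (intro borel_measurable_continuous_on_indicator continuous_intros
      continuous_on_compose2[OF continuous_on_deriv])
    show "(\<lambda>x. complex_of_real (snd x) * cis (fst x)) ` ?S \<subseteq> ball 0 1"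
      using that by (auto simp: norm_mult)
  qed (auto intro!: borel_Times)
  then have "(\<lambda>x. ennreal (indicator ?S x *\<^sub>R norm (deriv u (of_real (snd x) * cis (fst x)))))
      \<in> borel_measurable (borel \<Otimes>\<^sub>M borel)"
    unfolding borel_prod by measurable
  also have "(\<lambda>x. ennreal (indicator ?S x *\<^sub>R norm (deriv u (of_real (snd x) * cis (fst x)))))
     = (\<lambda>x. ennreal (norm (deriv u (of_real (snd x) * cis (fst x)))) * indicator {0..<\<rho>} (snd x))"
    by (auto simp: indicator_def)
  finally show ?thesis .
qed

lemma radial_variation_borel [measurable]:
  "radial_variation u \<rho> \<in> borel_measurable borel" if "\<rho> \<le> 1"
proof -
  have "(\<lambda>(\<theta>, r). ennreal (norm (deriv u (of_real r * cis \<theta>))) * indicator {0..<\<rho>} r)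
      \<in> borel_measurable (borel \<Otimes>\<^sub>M lborel)"
    using radial_deriv_borel[OF that] by (simp add: case_prod_beta' cong: measurable_cong_sets sets_pair_measure_cong)
  then show ?thesis
    unfolding radial_variation_def[abs_def] by (rule lborel.borel_measurable_nn_integral)
qed

lemma radial_slice_borel [measurable]:
  "(\<lambda>r. ennreal (norm (deriv u (of_real r * cis \<theta>))) * indicator {0..<\<rho>} r) \<in> borel_measurable borel"
  if "\<rho> \<le> 1"
  using measurable_compose[OF measurable_Pair1' radial_deriv_borel[OF that], of \<theta>] by simp

lemma radial_variation_finite:
  assumes "\<rho> < 1"
  shows "radial_variation u \<rho> \<theta> < \<infinity>"
proof -
  have "compact (deriv u ` cball 0 \<rho>)"
    using assms by (intro compact_continuous_image continuous_on_subset[OF continuous_on_deriv]) auto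
  then obtain B where B: "\<And>z. z \<in> cball 0 \<rho> \<Longrightarrow> norm (deriv u z) \<le> B"
    by (meson bounded_iff compact_imp_bounded imageI)
  have "radial_variation u \<rho> \<theta> \<le> (\<integral>\<^sup>+r. ennreal B * indicator {0..1::real} r \<partial>lborel)"
    unfolding radial_variation_def
    by (intro nn_integral_mono)
      (use assms in \<open>auto simp: indicator_def norm_mult intro!: ennreal_leI B\<close>)
  also have "\<dots> < \<infinity>"
    by (subst nn_integral_cmult) (auto simp: ennreal_mult_less_top)
  finally show ?thesis .
qed

lemma radial_variation_mono: "\<rho> \<le> \<rho>' \<Longrightarrow> radial_variation u \<rho> \<theta> \<le> radial_variation u \<rho>' \<theta>"
  unfolding radial_variation_def by (intro nn_integral_mono) (auto simp: indicator_def)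

text \<open>The substitution of \<open>\<rho> * r\<close> for \<open>r\<close>. It makes estimates
  for functions continuous on the closed disc applicable to \<open>u\<close> below radius
  \<rho>.\<close>

lemma radial_variation_dilate:
  assumes "0 < \<rho>" "\<rho> < 1"
  shows "radial_variation u \<rho> \<theta> = radial_variation (dilate u \<rho>) 1 \<theta>"
proof -
  have d: "deriv (dilate u \<rho>) (of_real r * cis \<theta>) = of_real \<rho> * deriv u (of_real (\<rho> * r) * cis \<theta>)"
    if "0 \<le> r" "r < 1" for r
  proof -
    have "\<rho> * r < 1" using assms that mult_strict_mono[of \<rho> 1 r 1] by simp
    then have "(u has_field_derivative deriv u (of_real (\<rho> * r) * cis \<theta>)) (at (of_real \<rho> * (of_real r * cis \<theta>)))"
      using assms that holomorphic_derivI[OF hol, of "of_real (\<rho> * r) * cis \<theta>"] by (simp add: norm_mult mult.assoc)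
    then have "((\<lambda>z. u (of_real \<rho> * z)) has_field_derivative deriv u (of_real (\<rho> * r) * cis \<theta>) * of_real \<rho>)
       (at (of_real r * cis \<theta>))"
      by (rule DERIV_chain2) (auto intro!: derivative_eq_intros)
    then show ?thesis unfolding dilate_def by (simp add: DERIV_imp_deriv mult.commute)
  qed
  have "radial_variation u \<rho> \<theta> = ennreal \<bar>\<rho>\<bar> *
     (\<integral>\<^sup>+r. ennreal (norm (deriv u (of_real (0 + \<rho> * r) * cis \<theta>))) * indicator {0..<\<rho>} (0 + \<rho> * r) \<partial>lborel)"
    unfolding radial_variation_def using assms
    by (intro nn_integral_real_affine radial_slice_borel) auto
  also have "\<dots> = (\<integral>\<^sup>+r. ennreal \<bar>\<rho>\<bar> *
     (ennreal (norm (deriv u (of_real (0 + \<rho> * r) * cis \<theta>))) * indicator {0..<\<rho>} (0 + \<rho> * r)) \<partial>lborel)"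
    using assms by (intro nn_integral_cmult[symmetric] measurable_compose[OF _ radial_slice_borel]) auto
  also have "\<dots> = radial_variation (dilate u \<rho>) 1 \<theta>"
    unfolding radial_variation_def
  proof (intro nn_integral_cong)
    fix r :: real
    have "(\<rho> * r < \<rho>) = (r < 1)" "(0 \<le> \<rho> * r) = (0 \<le> r)"
      using assms by (auto simp: zero_le_mult_iff)
    then show "ennreal \<bar>\<rho>\<bar> * (ennreal (norm (deriv u (of_real (0 + \<rho> * r) * cis \<theta>))) * indicator {0..<\<rho>} (0 + \<rho> * r))
      = ennreal (norm (deriv (dilate u \<rho>) (of_real r * cis \<theta>))) * indicator {0..<1} r"
      using assms d[of r] by (auto simp: indicator_def norm_mult ennreal_mult)
  qed
  finally show ?thesis .
qed

lemma radial_has_integral: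
  assumes "0 \<le> r" "r < 1"
  shows "((\<lambda>x. deriv u (of_real x * cis \<theta>) * cis \<theta>) has_integral (u (of_real r * cis \<theta>) - u 0)) {0..r}"
proof -
  have "((\<lambda>x. deriv u (of_real x * cis \<theta>) * cis \<theta>) has_integral
      (u (of_real r * cis \<theta>) - u (of_real 0 * cis \<theta>))) {0..r}"
  proof (rule fundamental_theorem_of_calculus[OF assms(1)])
    fix x assume "x \<in> {0..r}"
    then have "(u has_field_derivative deriv u (of_real x * cis \<theta>)) (at (of_real x * cis \<theta>))"
      using assms by (intro holomorphic_derivI[OF hol]) (auto simp: norm_mult)
    then have "((\<lambda>z. u (z * cis \<theta>)) has_field_derivative deriv u (of_real x * cis \<theta>) * cis \<theta>) (at (of_real x))"
      by (rule DERIV_chain2) (auto intro!: derivative_eq_intros)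
    then show "((\<lambda>x. u (of_real x * cis \<theta>)) has_vector_derivative deriv u (of_real x * cis \<theta>) * cis \<theta>)
        (at x within {0..r})"
      by (rule has_vector_derivative_real_field)
  qed
  then show ?thesis by simp
qed

text \<open>The fundamental theorem of calculus along the radius. With \<open>r < \<rho>\<close> the
  closed interval up to \<open>r\<close> lies in the half-open one defining the variation.\<close>

lemma norm_le_radial_variation:
  assumes "0 \<le> r" "r < \<rho>" "\<rho> < 1"
  shows "norm (u (of_real r * cis \<theta>)) \<le> norm (u 0) + enn2real (radial_variation u \<rho> \<theta>)"
proof -
  have "ennreal (norm (u (of_real r * cis \<theta>) - u 0))
      \<le> (\<integral>\<^sup>+x\<in>{0..r}. ennreal (norm (deriv u (of_real x * cis \<theta>) * cis \<theta>)) \<partial>lborel)"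
    using assms by (intro norm_has_integral_le_nn_integral radial_has_integral continuous_intros
        continuous_on_compose2[OF continuous_on_deriv]) (auto simp: norm_mult)
  also have "\<dots> \<le> radial_variation u \<rho> \<theta>"
    unfolding radial_variation_def using assms
    by (intro nn_integral_mono) (auto simp: indicator_def norm_mult)
  also have "\<dots> = ennreal (enn2real (radial_variation u \<rho> \<theta>))"
    using radial_variation_finite[OF assms(3)] by (simp add: less_top)
  finally have "norm (u (of_real r * cis \<theta>) - u 0) \<le> enn2real (radial_variation u \<rho> \<theta>)"
    by simp
  then show ?thesis using norm_triangle_sub[of "u (of_real r * cis \<theta>)" "u 0"] by linarith
qed

text \<open>With finite variation the derivative along the radius is absolutely integrable up to 1,
  so its indefinite integral is continuous there.\<close>

lemma radial_limit_exists:
  assumes fin: "radial_variation u 1 \<theta> < \<infinity>"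
  shows "\<exists>L. ((\<lambda>r. u (of_real r * cis \<theta>)) \<longlongrightarrow> L) (at_left 1)"
proof -
  define \<phi> where "\<phi> = (\<lambda>x. indicator {0..<1} x *\<^sub>R (deriv u (of_real x * cis \<theta>) * cis \<theta>))"
  have [measurable]: "\<phi> \<in> borel_measurable borel"
    unfolding \<phi>_def
    by (intro borel_measurable_continuous_on_indicator continuous_intros
        continuous_on_compose2[OF continuous_on_deriv]) (auto simp: norm_mult)
  have "(\<integral>\<^sup>+x. ennreal (norm (\<phi> x)) \<partial>lborel) = radial_variation u 1 \<theta>"
    unfolding radial_variation_def \<phi>_def by (intro nn_integral_cong) (auto simp: indicator_def norm_mult)
  then have "integrable lborel \<phi>" using fin by (intro integrableI_bounded) auto
  then have "\<phi> integrable_on UNIV" by (rule integrable_on_lborel)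
  then have int: "\<phi> integrable_on {0..1}" by (rule integrable_on_subinterval) auto
  have "continuous_on {0..1} (\<lambda>r. integral {0..r} \<phi>)"
    by (rule indefinite_integral_continuous_1[OF int])
  then have "((\<lambda>r. integral {0..r} \<phi>) \<longlongrightarrow> integral {0..1} \<phi>) (at 1 within {0..1})"
    by (auto simp: continuous_on_def)
  then have "((\<lambda>r. integral {0..r} \<phi>) \<longlongrightarrow> integral {0..1} \<phi>) (at_left 1)"
    by (simp add: at_within_Icc_at_left)
  then have "((\<lambda>r. u 0 + integral {0..r} \<phi>) \<longlongrightarrow> u 0 + integral {0..1} \<phi>) (at_left 1)"
    by (intro tendsto_intros)
  moreover have "\<forall>\<^sub>F r in at_left (1::real). u 0 + integral {0..r} \<phi> = u (of_real r * cis \<theta>)"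
    using eventually_at_left_real[OF zero_less_one]
  proof eventually_elim
    case (elim r)
    have "(\<phi> has_integral (u (of_real r * cis \<theta>) - u 0)) {0..r}"
      using radial_has_integral[of r \<theta>] elim
      by (rule_tac has_integral_eq[rotated]) (auto simp: \<phi>_def indicator_def)
    then show ?case by (simp add: integral_unique)
  qed
  ultimately show ?thesis by (blast intro: Lim_transform_eventually)
qed

end

subsection \<open>Radial boundary values\<close>

text \<open>An increasing sequence of radii tending to 1, used for countable suprema and for
  monotone convergence; the summand 2 makes it start at \<open>1 / 2\<close>, inside the open unit
  interval.\<close>

definition radius_seq :: "nat \<Rightarrow> real" where
  "radius_seq n = 1 - 1 / (real n + 2)"

lemma radius_seq: "0 < radius_seq n" "radius_seq n < 1" "\<bar>radius_seq n\<bar> < 1"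
  by (auto simp: radius_seq_def)

lemma radius_seq_mono: "m \<le> n \<Longrightarrow> radius_seq m \<le> radius_seq n"
  by (auto simp: radius_seq_def field_simps)

lemma radius_seq_LIMSEQ: "radius_seq \<longlonglongrightarrow> 1"
  unfolding radius_seq_def by real_asymp

lemma radius_seq_exceeds: "r < 1 \<Longrightarrow> \<exists>n. r < radius_seq n"
  using order_tendstoD(1)[OF radius_seq_LIMSEQ, of r] by (auto simp: eventually_sequentially)

lemma radius_seq_at_left: "filterlim radius_seq (at_left 1) sequentially"
  unfolding filterlim_at by (auto simp: radius_seq radius_seq_LIMSEQ less_imp_neq)

lemma add_powr_le:
  fixes a b p :: real
  assumes "0 \<le> a" "0 \<le> b" "0 \<le> p"
  shows "(a + b) powr p \<le> 2 powr p * (a powr p + b powr p)"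
proof -
  have "(a + b) powr p \<le> (2 * max a b) powr p"
    using assms by (intro powr_mono2) auto
  also have "\<dots> = 2 powr p * max a b powr p"
    by (simp add: powr_mult)
  also have "\<dots> \<le> 2 powr p * (a powr p + b powr p)"
    by (intro mult_left_mono) (auto simp: max_def)
  finally show ?thesis .
qed

lemma norm_diff_powr_le:
  fixes a b :: "'a::real_normed_vector"
  assumes "0 \<le> p"
  shows "ennreal (norm (a - b) powr p) \<le> ennreal (2 powr p) * (ennreal (norm a powr p) + ennreal (norm b powr p))"
proof -
  have "norm (a - b) powr p \<le> (norm a + norm b) powr p"
    using assms by (intro powr_mono2 norm_triangle_ineq4) auto
  also have "\<dots> \<le> 2 powr p * (norm a powr p + norm b powr p)"
    using assms by (intro add_powr_le) auto
  finally have "ennreal (norm (a - b) powr p) \<le> ennreal (2 powr p * (norm a powr p + norm b powr p))"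
    by (rule ennreal_leI)
  then show ?thesis by (simp add: ennreal_mult' ennreal_plus)
qed

lemma tendsto_ennreal_norm_powr:
  assumes "(f \<longlongrightarrow> a) F" "0 < p"
  shows "((\<lambda>x. ennreal (norm (f x) powr p)) \<longlongrightarrow> ennreal (norm a powr p)) F"
  using assms by (intro tendsto_ennrealI tendsto_powr' tendsto_norm tendsto_const) auto

text \<open>A majorant of the \<open>p\<close>-th powers of all \<open>u\<close> at radii below 1.
  The supremum runs over radii where the variation is finite: at radius 1, \<open>enn2real\<close>
  would turn an infinite variation into 0.\<close>

definition radial_max :: "real \<Rightarrow> (complex \<Rightarrow> complex) \<Rightarrow> real \<Rightarrow> ennreal" where
  "radial_max p u \<theta> = ennreal (2 powr p) * (ennreal (norm (u 0) powr p) +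
     (SUP n. ennreal (enn2real (radial_variation u (radius_seq n) \<theta>) powr p)))"

text \<open>The limit along a fixed sequence yields a function that is Borel on the whole circle; it
  equals the radial limit wherever the latter exists.\<close>

definition radial_trace :: "(complex \<Rightarrow> complex) \<Rightarrow> complex \<Rightarrow> complex" where
  "radial_trace u \<xi> = lim (\<lambda>n. u (of_real (radius_seq n) * \<xi>))"

context
  fixes u :: "complex \<Rightarrow> complex" and p :: real
  assumes hol: "u holomorphic_on ball 0 1" and p: "1 < p"
begin

lemma radial_max_borel [measurable]: "radial_max p u \<in> borel_measurable borel"
proof -
  have [measurable]: "radial_variation u (radius_seq n) \<in> borel_measurable borel" for n
    using radius_seq(2)[of n] by (intro radial_variation_borel hol) auto
  show ?thesis unfolding radial_max_def[abs_def] by measurable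
qed

lemma radial_max_periodic: "radial_max p u (\<theta> + 2 * pi) = radial_max p u \<theta>"
  by (simp add: radial_max_def radial_variation_def)

lemma norm_powr_le_radial_max:
  assumes "0 \<le> r" "r < 1"
  shows "ennreal (norm (u (of_real r * cis \<theta>)) powr p) \<le> radial_max p u \<theta>"
proof -
  obtain n where n: "r < radius_seq n" using radius_seq_exceeds[OF assms(2)] by blast
  let ?g = "enn2real (radial_variation u (radius_seq n) \<theta>)"
  have "norm (u (of_real r * cis \<theta>)) powr p \<le> (norm (u 0) + ?g) powr p"
    using p assms n radius_seq by (intro powr_mono2 norm_le_radial_variation hol) auto
  also have "\<dots> \<le> 2 powr p * (norm (u 0) powr p + ?g powr p)"
    using p by (intro add_powr_le) auto
  finally have "ennreal (norm (u (of_real r * cis \<theta>)) powr p) \<le> ennreal (2 powr p * (norm (u 0) powr p + ?g powr p))"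
    by (rule ennreal_leI)
  also have "\<dots> = ennreal (2 powr p) * (ennreal (norm (u 0) powr p) + ennreal (?g powr p))"
    by (simp add: ennreal_mult' ennreal_plus)
  also have "\<dots> \<le> radial_max p u \<theta>"
    unfolding radial_max_def by (intro mult_left_mono add_left_mono SUP_upper) auto
  finally show ?thesis .
qed

text \<open>The majorant bounds the variations up to all \<open>radius_seq n\<close> uniformly, and
  monotone convergence carries the bound to radius 1.\<close>

lemma radial_variation_finite_of_radial_max:
  assumes "radial_max p u \<theta> \<noteq> \<infinity>"
  shows "radial_variation u 1 \<theta> < \<infinity>"
proof -
  let ?g = "\<lambda>n. radial_variation u (radius_seq n) \<theta>"
  obtain B where B: "0 \<le> B" "(SUP n. ennreal (enn2real (?g n) powr p)) = ennreal B"
  proof -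
    have "(SUP n. ennreal (enn2real (?g n) powr p)) \<noteq> \<infinity>"
      using assms by (auto simp: radial_max_def ennreal_mult_eq_top_iff)
    then show ?thesis using that by (metis ennreal_cases infinity_ennreal_def)
  qed
  have g: "?g n \<le> ennreal (B powr (1 / p))" for n
  proof -
    have "ennreal (enn2real (?g n) powr p) \<le> ennreal B"
      unfolding B(2)[symmetric] by (rule SUP_upper) simp
    then have "enn2real (?g n) powr p \<le> B" using B by simp
    then have "(enn2real (?g n) powr p) powr (1 / p) \<le> B powr (1 / p)"
      using p by (intro powr_mono2) auto
    then have "enn2real (?g n) \<le> B powr (1 / p)" using p by (simp add: powr_powr)
    then have "ennreal (enn2real (?g n)) \<le> ennreal (B powr (1 / p))" by (rule ennreal_leI)
    moreover have "ennreal (enn2real (?g n)) = ?g n"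
      using radial_variation_finite[OF hol radius_seq(2), of n \<theta>] by (simp add: less_top)
    ultimately show ?thesis by (simp del: ennreal_enn2real)
  qed
  define h where "h = (\<lambda>\<rho> r. ennreal (norm (deriv u (of_real r * cis \<theta>))) * indicator {0..<\<rho>} r)"
  have [measurable]: "h (radius_seq n) \<in> borel_measurable borel" for n
    unfolding h_def using radius_seq(2)[of n] by (intro radial_slice_borel hol) auto
  have sup: "(SUP n. h (radius_seq n) r) = h 1 r" for r
  proof (rule antisym)
    show "(SUP n. h (radius_seq n) r) \<le> h 1 r"
      by (intro SUP_least) (auto simp: h_def indicator_def dest: order_less_trans[OF _ radius_seq(2)])
    show "h 1 r \<le> (SUP n. h (radius_seq n) r)"
    proof (cases "r < 1")
      case True
      then obtain n where "r < radius_seq n" using radius_seq_exceeds by blast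
      with True have "h 1 r = h (radius_seq n) r" by (auto simp: h_def indicator_def)
      then show ?thesis by (metis SUP_upper UNIV_I)
    qed (auto simp: h_def)
  qed
  have "radial_variation u 1 \<theta> = (\<integral>\<^sup>+r. (SUP n. h (radius_seq n) r) \<partial>lborel)"
    by (simp only: sup) (simp add: radial_variation_def h_def)
  also have "\<dots> = (SUP n. \<integral>\<^sup>+r. h (radius_seq n) r \<partial>lborel)"
  proof (rule nn_integral_monotone_convergence_SUP)
    show "incseq (\<lambda>n. h (radius_seq n))"
      using radius_seq_mono by (auto simp: incseq_def le_fun_def h_def indicator_def intro: order_less_le_trans)
  qed auto
  also have "\<dots> \<le> ennreal (B powr (1 / p))"
    using g by (intro SUP_least) (simp add: radial_variation_def h_def)
  finally show ?thesis by (simp add: order_le_less_trans)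
qed

lemma radial_trace_tendsto:
  assumes "radial_max p u \<theta> \<noteq> \<infinity>"
  shows "((\<lambda>r. u (of_real r * cis \<theta>)) \<longlongrightarrow> radial_trace u (cis \<theta>)) (at_left 1)"
proof -
  obtain L where L: "((\<lambda>r. u (of_real r * cis \<theta>)) \<longlongrightarrow> L) (at_left 1)"
    using radial_limit_exists[OF hol radial_variation_finite_of_radial_max[OF assms]] by blast
  then have "(\<lambda>n. u (of_real (radius_seq n) * cis \<theta>)) \<longlonglongrightarrow> L"
    by (rule filterlim_compose[OF _ radius_seq_at_left])
  then have "radial_trace u (cis \<theta>) = L" unfolding radial_trace_def by (rule limI)
  with L show ?thesis by simp
qed

lemma radial_trace_borel: "(\<lambda>t. radial_trace u (cis t)) \<in> borel_measurable borel"
  unfolding radial_trace_def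
  by (intro borel_measurable_lim_metric dilate_borel hol radius_seq)

text \<open>The kernel estimate for the dilates has one constant \<open>K\<close>; integrated over
  \<theta> it bounds the \<open>p\<close>-th power of the variation by \<open>K * S\<close> for
  every radius of the sequence, and monotone convergence gives the supremum.\<close>

lemma radial_max_integral_finite:
  assumes s: "0 < s" and S: "S < \<infinity>"
    and bnd: "\<And>r. 0 < r \<Longrightarrow> r < 1 \<Longrightarrow> gagliardo_integral s p (\<lambda>t. u (of_real r * cis t)) \<le> S"
  shows "(\<integral>\<^sup>+\<theta>. radial_max p u \<theta> \<partial>arc_measure) < \<infinity>"
proof -
  obtain K where K: "\<And>v \<theta> x. continuous_on (cball 0 1) v \<Longrightarrow> v holomorphic_on ball 0 1 \<Longrightarrow> 0 \<le> x \<Longrightarrow>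
     ennreal x \<le> radial_variation v 1 \<theta> \<Longrightarrow>
     ennreal (x powr p) \<le> ennreal K *
       (\<integral>\<^sup>+t. ennreal (norm (v (cis (\<theta> + t)) - v (cis \<theta>)) powr p / norm (cis t - 1) powr (1 + s * p)) \<partial>arc_measure)"
    using radial_variation_powr_le[OF s p] unfolding radial_variation_def by blast
  let ?g = "\<lambda>n \<theta>. enn2real (radial_variation u (radius_seq n) \<theta>)"
  have [measurable]: "radial_variation u (radius_seq n) \<in> borel_measurable borel" for n
    using radius_seq(2)[of n] by (intro radial_variation_borel hol) auto
  have le: "(\<integral>\<^sup>+\<theta>. ennreal (?g n \<theta> powr p) \<partial>arc_measure) \<le> ennreal K * S" for n
  proof -
    let ?v = "dilate u (radius_seq n)"
    let ?F = "\<lambda>t. u (of_real (radius_seq n) * cis t)"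
    have [measurable]: "?F \<in> borel_measurable borel"
      using radius_seq[of n] by (intro dilate_borel hol) auto
    have "(\<integral>\<^sup>+\<theta>. ennreal (?g n \<theta> powr p) \<partial>arc_measure)
      \<le> (\<integral>\<^sup>+\<theta>. ennreal K * (\<integral>\<^sup>+t. ennreal (norm (?F (\<theta> + t) - ?F \<theta>) powr p / norm (cis t - 1) powr (1 + s * p)) \<partial>arc_measure)
          \<partial>arc_measure)"
    proof (rule nn_integral_mono)
      fix \<theta>
      \<comment> \<open>The variation below radius 1 is finite, so \<open>enn2real\<close> loses
        nothing.\<close>
      have "ennreal (?g n \<theta>) = radial_variation ?v 1 \<theta>"
        using radial_variation_finite[OF hol radius_seq(2), of n \<theta>] radius_seq[of n]
        by (simp add: radial_variation_dilate[OF hol] less_top)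
      then show "ennreal (?g n \<theta> powr p)
         \<le> ennreal K * (\<integral>\<^sup>+t. ennreal (norm (?F (\<theta> + t) - ?F \<theta>) powr p / norm (cis t - 1) powr (1 + s * p)) \<partial>arc_measure)"
        using K[of ?v "?g n \<theta>" \<theta>] radius_seq[of n] dilate_continuous[OF hol] dilate_holomorphic[OF hol]
        by (simp add: dilate_def)
    qed
    also have "\<dots> = ennreal K * gagliardo_integral s p ?F"
      unfolding gagliardo_integral_def by (rule nn_integral_cmult) measurable
    also have "\<dots> \<le> ennreal K * S"
      using radius_seq by (intro mult_left_mono bnd) auto
    finally show ?thesis .
  qed
  have "(\<integral>\<^sup>+\<theta>. (SUP n. ennreal (?g n \<theta> powr p)) \<partial>arc_measure) = (SUP n. \<integral>\<^sup>+\<theta>. ennreal (?g n \<theta> powr p) \<partial>arc_measure)"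
  proof (rule nn_integral_monotone_convergence_SUP)
    show "incseq (\<lambda>n \<theta>. ennreal (?g n \<theta> powr p))"
      using p radial_variation_finite[OF hol radius_seq(2)]
      by (auto simp: incseq_def le_fun_def less_top
          intro!: ennreal_leI powr_mono2 enn2real_mono radial_variation_mono[OF hol] radius_seq_mono)
  qed auto
  also have "\<dots> \<le> ennreal K * S" by (intro SUP_least le)
  finally have "(\<integral>\<^sup>+\<theta>. (SUP n. ennreal (?g n \<theta> powr p)) \<partial>arc_measure) < \<infinity>"
    using S by (auto intro: order_le_less_trans simp: ennreal_mult_less_top)
  then show ?thesis
    unfolding radial_max_def
    by (subst nn_integral_cmult, measurable, subst nn_integral_add)
      (auto simp: ennreal_mult_less_top emeasure_arc_UNIV)
qed

end

subsection \<open>Convergence at the boundary\<close>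

text \<open>Reduction to sequences tending to 1. Raising the terms below \<open>1 / 2\<close> to
  \<open>1 / 2\<close> keeps the sequence where the hypotheses apply and does not affect its
  tail.\<close>

lemma nn_integral_dominated_convergence_at_left:
  fixes f :: "real \<Rightarrow> 'a \<Rightarrow> ennreal"
  assumes f: "\<And>r. 0 < r \<Longrightarrow> r < 1 \<Longrightarrow> f r \<in> borel_measurable M"
    and g: "g \<in> borel_measurable M" and w: "w \<in> borel_measurable M"
    and bnd: "\<And>r. 0 < r \<Longrightarrow> r < 1 \<Longrightarrow> AE x in M. f r x \<le> w x"
    and fin: "(\<integral>\<^sup>+x. w x \<partial>M) < \<infinity>"
    and lim: "AE x in M. ((\<lambda>r. f r x) \<longlongrightarrow> g x) (at_left 1)"
  shows "((\<lambda>r. \<integral>\<^sup>+x. f r x \<partial>M) \<longlongrightarrow> (\<integral>\<^sup>+x. g x \<partial>M)) (at_left 1)"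
  unfolding tendsto_at_iff_sequentially
proof (intro allI impI)
  fix X :: "nat \<Rightarrow> real"
  assume X: "\<forall>i. X i \<in> {..<1} - {1}" "X \<longlonglongrightarrow> 1"
  define Y where "Y = (\<lambda>i. max (X i) (1 / 2))"
  have Y: "0 < Y i" "Y i < 1" for i using X by (auto simp: Y_def)
  have "Y \<longlonglongrightarrow> max 1 (1 / 2)" unfolding Y_def by (intro tendsto_max X tendsto_const)
  then have "filterlim Y (at_left 1) sequentially"
    using Y by (auto simp: filterlim_at less_imp_neq max_def)
  then have "(\<lambda>i. \<integral>\<^sup>+x. f (Y i) x \<partial>M) \<longlonglongrightarrow> (\<integral>\<^sup>+x. g x \<partial>M)"
    using lim by (intro nn_integral_dominated_convergence[OF f[OF Y] g w bnd[OF Y] fin])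
      (auto elim: eventually_mono filterlim_compose)
  moreover have "\<forall>\<^sub>F i in sequentially. (\<integral>\<^sup>+x. f (Y i) x \<partial>M) = (\<integral>\<^sup>+x. f (X i) x \<partial>M)"
    using order_tendstoD(1)[OF X(2), of "1 / 2"] by (auto simp: Y_def max_def elim: eventually_mono)
  ultimately show "((\<lambda>r. \<integral>\<^sup>+x. f r x \<partial>M) \<circ> X) \<longlonglongrightarrow> (\<integral>\<^sup>+x. g x \<partial>M)"
    unfolding o_def by (rule Lim_transform_eventually)
qed

theorem theorem6:
  fixes s p :: real and u :: "complex \<Rightarrow> complex"
  assumes "0 < s" and "s < 1" and "1 < p"
    and "u analytic_on ball 0 1"
    and "(SUP r\<in>{0<..<1}. gagliardo_seminorm s p (dilate u r)) < \<infinity>"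
  shows "u \<in> hardy_space p \<and>
    (\<exists>ustar.
      ustar \<in> Lp_circle p \<and>
      (AE \<theta> in lebesgue_on {-pi<..<pi}.
        ((\<lambda>r. u (of_real r * cis \<theta>)) \<longlongrightarrow> ustar (cis \<theta>)) (at_left (1::real))) \<and>
      ((\<lambda>r. Lp_norm_circle p (\<lambda>\<xi>. dilate u r \<xi> - ustar \<xi>)) \<longlongrightarrow> 0) (at_left 1) \<and>
      ustar \<in> sobolev_circle s p \<and>
      ((\<lambda>r. gagliardo_seminorm s p (\<lambda>\<xi>. dilate u r \<xi> - ustar \<xi>)) \<longlongrightarrow> 0) (at_left 1) \<and>
      ((\<lambda>r. gagliardo_seminorm s p (dilate u r)) \<longlongrightarrow> gagliardo_seminorm s p ustar) (at_left 1))"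
proof -

  \<comment> \<open>The majorant and the boundary values\<close>
  have p: "1 < p" "0 < p" "0 \<le> p" and s: "0 < s" using assms by auto
  have hol: "u holomorphic_on ball 0 1"
    using assms by (simp add: analytic_on_open)
  define f where "f = (\<lambda>r t. u (of_real r * cis t))"
  define ustar where "ustar = radial_trace u"
  define T where "T = (\<lambda>t. ustar (cis t))"
  define w where "w = radial_max p u"
  have fm: "f r \<in> borel_measurable borel" if "0 \<le> r" "r < 1" for r
    unfolding f_def using that by (intro dilate_borel hol) auto
  have Tm[measurable]: "T \<in> borel_measurable borel"
    unfolding T_def ustar_def by (rule radial_trace_borel[OF hol p(1)])
  have wm[measurable]: "w \<in> borel_measurable borel"
    unfolding w_def by (rule radial_max_borel[OF hol p(1)])
  \<comment> \<open>The assumed supremum is finite, so its \<open>p\<close>-th power may be taken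
    through \<open>enn2real\<close>; it bounds all Gagliardo integrals.\<close>
  define S where "S = ennreal (enn2real (SUP r\<in>{0<..<1}. gagliardo_seminorm s p (dilate u r)) powr p)"
  have S: "gagliardo_integral s p (f r) \<le> S" if r: "0 < r" "r < 1" for r
    unfolding S_def
  proof (rule le_of_ennreal_powr_le)
    have "ennreal_powr (gagliardo_integral s p (f r)) (1 / p) = gagliardo_seminorm s p (dilate u r)"
      using fm[of r] r by (subst gagliardo_seminorm_eq) (auto simp: f_def dilate_def)
    also have "\<dots> \<le> (SUP r\<in>{0<..<1}. gagliardo_seminorm s p (dilate u r))"
      using r by (intro SUP_upper) auto
    finally show "ennreal_powr (gagliardo_integral s p (f r)) (1 / p)
      \<le> (SUP r\<in>{0<..<1}. gagliardo_seminorm s p (dilate u r))" .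
  qed (use assms in auto)
  have wfin: "(\<integral>\<^sup>+\<theta>. w \<theta> \<partial>arc_measure) < \<infinity>"
    unfolding w_def
    using S by (intro radial_max_integral_finite[OF hol p(1) s, of S]) (auto simp: f_def S_def)
  have wfin_rot: "(\<integral>\<^sup>+\<theta>. w (\<theta> + t) \<partial>arc_measure) < \<infinity>" for t
    using wfin nn_integral_arc_rotate[OF wm, of t]
    by (simp add: w_def radial_max_periodic[OF hol p(1)])
  \<comment> \<open>Translates are included because differences of values at
    \<open>\<theta> + t\<close> and \<theta> require both angles to be good.\<close>
  have wAE: "AE \<theta> in arc_measure. w (\<theta> + t) \<noteq> \<infinity>" for t
    using wfin_rot[of t] by (intro nn_integral_PInf_AE) auto
  have fle: "ennreal (norm (f r \<theta>) powr p) \<le> w \<theta>" if "0 \<le> r" "r < 1" for r \<theta>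
    unfolding f_def w_def using that by (intro norm_powr_le_radial_max[OF hol p(1)])
  have conv: "((\<lambda>r. f r \<theta>) \<longlongrightarrow> T \<theta>) (at_left 1)" if "w \<theta> \<noteq> \<infinity>" for \<theta>
    unfolding f_def T_def ustar_def using that unfolding w_def by (rule radial_trace_tendsto[OF hol p(1)])
  have ev: "\<forall>\<^sub>F r in at_left (1::real). r \<in> {0<..<1}"
    by (rule eventually_at_left_real) simp
  have Tle: "ennreal (norm (T \<theta>) powr p) \<le> w \<theta>" for \<theta>
  proof (cases "w \<theta> = \<infinity>")
    case False
    show ?thesis
      using ev by (intro tendsto_upperbound[OF tendsto_ennreal_norm_powr[OF conv[OF False] p(2)]])
        (auto elim!: eventually_mono intro!: fle)
  qed simp

  \<comment> \<open>Translation differences for fixed \<open>t\<close>\<close>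
  define mf where "mf = (\<lambda>r t. \<integral>\<^sup>+\<theta>. ennreal (norm (f r (\<theta> + t) - f r \<theta>) powr p) \<partial>arc_measure)"
  define mT where "mT = (\<lambda>t. \<integral>\<^sup>+\<theta>. ennreal (norm (T (\<theta> + t) - T \<theta>) powr p) \<partial>arc_measure)"
  define md where "md = (\<lambda>r t. \<integral>\<^sup>+\<theta>. ennreal (norm ((f r (\<theta> + t) - T (\<theta> + t)) - (f r \<theta> - T \<theta>)) powr p) \<partial>arc_measure)"
  \<comment> \<open>Division by zero gives \<open>k t = 0\<close> where \<open>cis t = 1\<close>, so
    \<open>k\<close> is finite everywhere and multiplication by \<open>k t\<close> is
    continuous.\<close>
  define k where "k = (\<lambda>t. ennreal (1 / norm (cis t - 1) powr (1 + s * p)))"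
  have km[measurable]: "k \<in> borel_measurable borel" unfolding k_def by measurable
  have mfm: "mf r \<in> borel_measurable borel" if "0 \<le> r" "r < 1" for r
    using fm[OF that] unfolding mf_def by measurable
  have mTm[measurable]: "mT \<in> borel_measurable borel"
    unfolding mT_def by measurable
  have mdm: "md r \<in> borel_measurable borel" if "0 \<le> r" "r < 1" for r
    using fm[OF that] unfolding md_def by measurable
  have gf: "gagliardo_integral s p (f r) = (\<integral>\<^sup>+t. mf r t * k t \<partial>arc_measure)" if "0 \<le> r" "r < 1" for r
    unfolding mf_def k_def by (rule gagliardo_integral_swap[OF fm[OF that]])
  have gT: "gagliardo_integral s p T = (\<integral>\<^sup>+t. mT t * k t \<partial>arc_measure)"
    unfolding mT_def k_def by (rule gagliardo_integral_swap[OF Tm])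
  have gd: "gagliardo_integral s p (\<lambda>t. f r t - T t) = (\<integral>\<^sup>+t. md r t * k t \<partial>arc_measure)" if "0 \<le> r" "r < 1" for r
    unfolding md_def k_def by (intro gagliardo_integral_swap borel_measurable_diff fm Tm that)
  have kmult: "((\<lambda>r. g r * k t) \<longlongrightarrow> L * k t) F" if "(g \<longlongrightarrow> L) F" for g :: "real \<Rightarrow> ennreal" and L F t
    using ennreal_tendsto_cmult[OF _ that, of "k t"] by (simp add: k_def mult.commute)

  \<comment> \<open>Dominates the translation differences of every \<open>f r\<close>, uniformly in
    \<open>r\<close>, for fixed \<open>t\<close>.\<close>
  define W where "W = (\<lambda>t \<theta>. ennreal (2 powr p) * (w (\<theta> + t) + w \<theta>))"
  have Wm[measurable]: "W t \<in> borel_measurable borel" for t unfolding W_def by measurable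
  have Wfin: "(\<integral>\<^sup>+\<theta>. c * W t \<theta> \<partial>arc_measure) < \<infinity>" if "c < \<infinity>" for t c
    unfolding W_def using wfin wfin_rot[of t] that
    by (simp add: nn_integral_cmult nn_integral_add ennreal_mult_less_top)
  have mf_lim: "((\<lambda>r. mf r t) \<longlongrightarrow> mT t) (at_left 1)" for t
    unfolding mf_def mT_def
  proof (rule nn_integral_dominated_convergence_at_left[where w = "\<lambda>\<theta>. 1 * W t \<theta>"])
    fix r :: real assume r: "0 < r" "r < 1"
    show "(\<lambda>\<theta>. ennreal (norm (f r (\<theta> + t) - f r \<theta>) powr p)) \<in> borel_measurable arc_measure"
      using fm[OF less_imp_le[OF r(1)] r(2)] by measurable
    show "AE \<theta> in arc_measure. ennreal (norm (f r (\<theta> + t) - f r \<theta>) powr p) \<le> 1 * W t \<theta>"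
      using r p unfolding W_def mult_1
      by (intro AE_I2 order_trans[OF norm_diff_powr_le] mult_left_mono add_mono fle) auto
  next
    show "AE \<theta> in arc_measure. ((\<lambda>r. ennreal (norm (f r (\<theta> + t) - f r \<theta>) powr p))
        \<longlongrightarrow> ennreal (norm (T (\<theta> + t) - T \<theta>) powr p)) (at_left 1)"
      using wAE[of t] wAE[of 0]
      by eventually_elim (intro tendsto_ennreal_norm_powr tendsto_diff conv p; simp)
  qed (use Wfin[of 1] in auto)
  have md_lim: "((\<lambda>r. md r t) \<longlongrightarrow> 0) (at_left 1)" for t
  proof -
    have "((\<lambda>r. md r t) \<longlongrightarrow> (\<integral>\<^sup>+\<theta>. 0 \<partial>arc_measure)) (at_left 1)"
      unfolding md_def
    \<comment> \<open>The inequality for \<open>p\<close>-th powers of differences is used twice,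
      giving two factors \<open>2 powr p\<close>, one of them inside \<open>W\<close>; the 2 comes
      from bounding both \<open>f r\<close> and \<open>T\<close> by \<open>w\<close>.\<close>
    proof (rule nn_integral_dominated_convergence_at_left[where w = "\<lambda>\<theta>. (ennreal (2 powr p) * 2) * W t \<theta>"])
      fix r :: real assume r: "0 < r" "r < 1"
      show "(\<lambda>\<theta>. ennreal (norm ((f r (\<theta> + t) - T (\<theta> + t)) - (f r \<theta> - T \<theta>)) powr p)) \<in> borel_measurable arc_measure"
        using fm[OF less_imp_le[OF r(1)] r(2)] by measurable
      show "AE \<theta> in arc_measure. ennreal (norm ((f r (\<theta> + t) - T (\<theta> + t)) - (f r \<theta> - T \<theta>)) powr p)
         \<le> (ennreal (2 powr p) * 2) * W t \<theta>"
      proof (rule AE_I2)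
        fix \<theta>
        have d: "ennreal (norm (f r \<theta> - T \<theta>) powr p) \<le> ennreal (2 powr p) * (w \<theta> + w \<theta>)" for \<theta>
          using r p by (intro order_trans[OF norm_diff_powr_le] mult_left_mono add_mono fle Tle) auto
        have "ennreal (norm ((f r (\<theta> + t) - T (\<theta> + t)) - (f r \<theta> - T \<theta>)) powr p)
          \<le> ennreal (2 powr p) * (ennreal (2 powr p) * (w (\<theta> + t) + w (\<theta> + t)) + ennreal (2 powr p) * (w \<theta> + w \<theta>))"
          by (rule order_trans[OF norm_diff_powr_le[OF p(3)]], intro mult_left_mono add_mono d) simp
        also have "\<dots> = (ennreal (2 powr p) * 2) * W t \<theta>"
          unfolding W_def mult_2[symmetric] by (simp add: algebra_simps)
        finally show "ennreal (norm ((f r (\<theta> + t) - T (\<theta> + t)) - (f r \<theta> - T \<theta>)) powr p)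
          \<le> (ennreal (2 powr p) * 2) * W t \<theta>" .
      qed
    next
      show "AE \<theta> in arc_measure. ((\<lambda>r. ennreal (norm ((f r (\<theta> + t) - T (\<theta> + t)) - (f r \<theta> - T \<theta>)) powr p))
          \<longlongrightarrow> 0) (at_left 1)"
        using wAE[of t] wAE[of 0]
      proof eventually_elim
        case (elim \<theta>)
        have "((\<lambda>r. ennreal (norm ((f r (\<theta> + t) - T (\<theta> + t)) - (f r \<theta> - T \<theta>)) powr p))
          \<longlongrightarrow> ennreal (norm ((T (\<theta> + t) - T (\<theta> + t)) - (T \<theta> - T \<theta>)) powr p)) (at_left 1)"
          using elim by (intro tendsto_ennreal_norm_powr tendsto_diff tendsto_const conv p) auto
        then show ?case by simp
      qed
    qed (auto intro!: Wfin[simplified] simp: ennreal_mult_less_top)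
    then show ?thesis by simp
  qed

  \<comment> \<open>For fixed \<open>t\<close>, \<open>mf r t\<close> is the \<open>p\<close>-th mean on the circle of radius \<open>r\<close> of the
    holomorphic function \<open>z \<mapsto> u (z * cis t) - u z\<close>, hence increasing in \<open>r\<close>; so \<open>mT\<close> dominates.\<close>
  have mf_mono: "mf r t \<le> mf \<rho> t" if r: "0 < r" "r < \<rho>" "\<rho> < 1" for r \<rho> t
  proof -
    \<comment> \<open>Dilating by \<rho> gives continuity on the closed disc; radius \<rho> becomes
      1 and radius \<open>r\<close> becomes \<open>r / \<rho>\<close>.\<close>
    let ?v = "\<lambda>z. dilate u \<rho> (z * cis t) - dilate u \<rho> z"
    have "(\<integral>\<^sup>+\<theta>. ennreal (norm (?v (of_real (r / \<rho>) * cis \<theta>)) powr p) \<partial>arc_measure)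
      \<le> (\<integral>\<^sup>+\<theta>. ennreal (norm (?v (cis \<theta>)) powr p) \<partial>arc_measure)"
    proof (rule nn_integral_arc_mean_le)
      show "continuous_on (cball 0 1) ?v"
        using r by (intro continuous_intros continuous_on_compose2[OF dilate_continuous[OF hol, of \<rho>]])
          (auto simp: norm_mult)
      show "?v holomorphic_on ball 0 1"
        using r by (intro holomorphic_intros holomorphic_on_compose_gen[OF _ dilate_holomorphic[OF hol, of \<rho>], unfolded o_def])
          (auto simp: norm_mult)
    qed (use r p in auto)
    moreover have "?v (of_real (r / \<rho>) * cis \<theta>) = f r (\<theta> + t) - f r \<theta>" for \<theta>
      using r by (simp add: dilate_def f_def cis_mult mult.assoc[symmetric])
    moreover have "?v (cis \<theta>) = f \<rho> (\<theta> + t) - f \<rho> \<theta>" for \<theta>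
      by (simp add: dilate_def f_def cis_mult)
    ultimately show ?thesis by (simp add: mf_def)
  qed
  have mf_le: "mf r t \<le> mT t" if r: "0 < r" "r < 1" for r t
  proof (rule tendsto_lowerbound[OF mf_lim])
    show "\<forall>\<^sub>F \<rho> in at_left 1. mf r t \<le> mf \<rho> t"
      using eventually_at_left_real[OF r(2)] by eventually_elim (use r in \<open>auto intro!: mf_mono\<close>)
  qed simp
  \<comment> \<open>Regrouping into translation differences of \<open>f r\<close> and of
    \<open>T\<close> gives a bound by \<open>mT\<close>, whose integral against \<open>k\<close>
    will be finite; the bound by \<open>W\<close> has no decay as \<open>t\<close> tends to
    0.\<close>
  have md_le: "md r t \<le> ennreal (2 powr p) * (mT t + mT t)" if r: "0 < r" "r < 1" for r t
  proof -
    have [measurable]: "f r \<in> borel_measurable borel" using r by (intro fm) auto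
    have "md r t \<le> (\<integral>\<^sup>+\<theta>. ennreal (2 powr p) * (ennreal (norm (f r (\<theta> + t) - f r \<theta>) powr p)
        + ennreal (norm (T (\<theta> + t) - T \<theta>) powr p)) \<partial>arc_measure)"
      unfolding md_def
    proof (rule nn_integral_mono)
      fix \<theta>
      have "(f r (\<theta> + t) - T (\<theta> + t)) - (f r \<theta> - T \<theta>) = (f r (\<theta> + t) - f r \<theta>) - (T (\<theta> + t) - T \<theta>)" by simp
      then show "ennreal (norm ((f r (\<theta> + t) - T (\<theta> + t)) - (f r \<theta> - T \<theta>)) powr p) \<le>
        ennreal (2 powr p) * (ennreal (norm (f r (\<theta> + t) - f r \<theta>) powr p) + ennreal (norm (T (\<theta> + t) - T \<theta>) powr p))"
        using norm_diff_powr_le[OF p(3)] by metis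
    qed
    also have "\<dots> = ennreal (2 powr p) * (mf r t + mT t)"
      unfolding mf_def mT_def by (subst nn_integral_cmult, measurable, subst nn_integral_add) auto
    also have "\<dots> \<le> ennreal (2 powr p) * (mT t + mT t)"
      by (intro mult_left_mono add_right_mono mf_le r) auto
    finally show ?thesis .
  qed

  \<comment> \<open>Convergence of the Gagliardo integrals\<close>
  have gTfin: "(\<integral>\<^sup>+t. mT t * k t \<partial>arc_measure) < \<infinity>"
  proof -
    have "(\<lambda>n. mf (radius_seq n) t * k t) \<longlonglongrightarrow> mT t * k t" for t
      by (rule filterlim_compose[OF kmult[OF mf_lim] radius_seq_at_left])
    then have "(\<integral>\<^sup>+t. mT t * k t \<partial>arc_measure) = (\<integral>\<^sup>+t. liminf (\<lambda>n. mf (radius_seq n) t * k t) \<partial>arc_measure)"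
      by (intro nn_integral_cong) (auto intro!: lim_imp_Liminf[symmetric])
    \<comment> \<open>Fatou's lemma along \<open>radius_seq\<close>; the integrals on the right are
      Gagliardo integrals of dilates, all at most \<open>S\<close>.\<close>
    also have "\<dots> \<le> liminf (\<lambda>n. \<integral>\<^sup>+t. mf (radius_seq n) t * k t \<partial>arc_measure)"
    proof (rule nn_integral_liminf)
      fix n
      have [measurable]: "mf (radius_seq n) \<in> borel_measurable borel"
        using radius_seq[of n] by (intro mfm) auto
      show "(\<lambda>t. mf (radius_seq n) t * k t) \<in> borel_measurable arc_measure" by measurable
    qed
    also have "\<dots> \<le> limsup (\<lambda>n. \<integral>\<^sup>+t. mf (radius_seq n) t * k t \<partial>arc_measure)"
      by (rule Liminf_le_Limsup) simp
    also have "\<dots> \<le> S"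
      using S radius_seq gf by (intro Limsup_bounded always_eventually) (auto simp: less_imp_le)
    also have "\<dots> < \<infinity>" by (simp add: S_def)
    finally show ?thesis .
  qed
  have gf_lim: "((\<lambda>r. \<integral>\<^sup>+t. mf r t * k t \<partial>arc_measure) \<longlongrightarrow> (\<integral>\<^sup>+t. mT t * k t \<partial>arc_measure)) (at_left 1)"
  \<comment> \<open>By monotonicity in \<open>r\<close> the limit itself is the dominating
    function.\<close>
  proof (rule nn_integral_dominated_convergence_at_left[where w = "\<lambda>t. mT t * k t"])
    fix r :: real assume r: "0 < r" "r < 1"
    show "(\<lambda>t. mf r t * k t) \<in> borel_measurable arc_measure" using mfm[OF less_imp_le[OF r(1)] r(2)] by measurable
    show "AE t in arc_measure. mf r t * k t \<le> mT t * k t"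
      by (intro AE_I2 mult_right_mono mf_le r) auto
  qed (auto intro!: gTfin[simplified] kmult mf_lim)
  have gd_lim: "((\<lambda>r. \<integral>\<^sup>+t. md r t * k t \<partial>arc_measure) \<longlongrightarrow> 0) (at_left 1)"
  proof -
    have "((\<lambda>r. \<integral>\<^sup>+t. md r t * k t \<partial>arc_measure) \<longlongrightarrow> (\<integral>\<^sup>+t. 0 * k t \<partial>arc_measure)) (at_left 1)"
    proof (rule nn_integral_dominated_convergence_at_left[where w = "\<lambda>t. (ennreal (2 powr p) * 2) * (mT t * k t)"])
      fix r :: real assume r: "0 < r" "r < 1"
      show "(\<lambda>t. md r t * k t) \<in> borel_measurable arc_measure" using mdm[OF less_imp_le[OF r(1)] r(2)] by measurable
      show "AE t in arc_measure. md r t * k t \<le> (ennreal (2 powr p) * 2) * (mT t * k t)"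
      proof (rule AE_I2)
        fix t
        have "md r t * k t \<le> (ennreal (2 powr p) * (mT t + mT t)) * k t"
          by (intro mult_right_mono md_le r) auto
        then show "md r t * k t \<le> (ennreal (2 powr p) * 2) * (mT t * k t)"
          by (simp add: mult_2[symmetric] mult_ac)
      qed
    next
      show "AE t in arc_measure. ((\<lambda>r. md r t * k t) \<longlongrightarrow> 0 * k t) (at_left 1)"
        by (intro AE_I2 kmult md_lim)
    next
      show "(\<integral>\<^sup>+t. (ennreal (2 powr p) * 2) * (mT t * k t) \<partial>arc_measure) < \<infinity>"
        using gTfin by (subst nn_integral_cmult) (auto simp: ennreal_mult_less_top)
    qed auto
    then show ?thesis by simp
  qed

  \<comment> \<open>Hardy bound, trace and limits of the norms\<close>
  have powr0: "ennreal_powr 0 (1 / p) = 0" by (simp add: ennreal_powr_def)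
  have hardy: "u \<in> hardy_space p"
  proof -
    have "hardy_norm p u \<le> ennreal_powr (ennreal (1 / (2 * pi)) * (\<integral>\<^sup>+\<theta>. w \<theta> \<partial>arc_measure)) (1 / p)"
      unfolding hardy_norm_def
    proof (rule SUP_least)
      fix r :: real assume r: "r \<in> {0..<1}"
      have [measurable]: "f r \<in> borel_measurable borel" using r by (intro fm) auto
      have "(\<integral>\<^sup>+\<theta>\<in>{0..2 * pi}. ennreal (norm (f r \<theta>) powr p) \<partial>lebesgue)
        = (\<integral>\<^sup>+\<theta>. ennreal (norm (f r \<theta>) powr p) \<partial>arc_measure)"
        unfolding nn_integral_completion by (rule nn_integral_arc_0_2pi) (measurable, simp add: f_def)
      also have "\<dots> \<le> (\<integral>\<^sup>+\<theta>. w \<theta> \<partial>arc_measure)"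
        using r by (intro nn_integral_mono fle) auto
      finally show "ennreal_powr (ennreal (1 / (2 * pi)) *
         (\<integral>\<^sup>+\<theta>\<in>{0..2 * pi}. ennreal (norm (u (of_real r * cis \<theta>)) powr p) \<partial>lebesgue)) (1 / p)
        \<le> ennreal_powr (ennreal (1 / (2 * pi)) * (\<integral>\<^sup>+\<theta>. w \<theta> \<partial>arc_measure)) (1 / p)"
        using p unfolding f_def by (intro ennreal_powr_mono mult_left_mono) auto
    qed
    also have "\<dots> < \<infinity>"
      using wfin by (simp add: ennreal_mult_less_top)
    finally show ?thesis using assms by (simp add: hardy_space_def)
  qed
  have Lp: "ustar \<in> Lp_circle p"
  proof -
    have "(\<integral>\<^sup>+t. ennreal (norm (T t) powr p) \<partial>arc_measure) \<le> (\<integral>\<^sup>+\<theta>. w \<theta> \<partial>arc_measure)"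
      by (intro nn_integral_mono Tle)
    then have "Lp_norm_circle p ustar < \<infinity>"
      using wfin Tm by (subst Lp_norm_circle_eq) (auto simp: T_def)
    moreover have "(\<lambda>\<theta>. ustar (cis \<theta>)) \<in> borel_measurable (lebesgue_on {-pi..pi})"
      using Tm unfolding T_def by (intro measurable_restrict_space1 measurable_completion) simp
    ultimately show ?thesis by (simp add: Lp_circle_def)
  qed
  have radial: "AE \<theta> in lebesgue_on {-pi<..<pi}.
        ((\<lambda>r. u (of_real r * cis \<theta>)) \<longlongrightarrow> ustar (cis \<theta>)) (at_left (1::real))"
  proof -
    have "AE \<theta> in lborel. \<theta> \<in> {-pi..pi} \<longrightarrow> w \<theta> \<noteq> \<infinity>"
      using wAE[of 0] unfolding arc_measure_def
      by (subst (asm) AE_density) (auto simp: indicator_def elim!: AE_mp)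
    then have "AE \<theta> in lebesgue. \<theta> \<in> {-pi<..<pi} \<longrightarrow>
        ((\<lambda>r. u (of_real r * cis \<theta>)) \<longlongrightarrow> ustar (cis \<theta>)) (at_left (1::real))"
      by (intro AE_completion) (auto elim!: eventually_mono intro!: conv[unfolded f_def T_def])
    then show ?thesis by (subst AE_restrict_space_iff) auto
  qed
  have Lp_lim: "((\<lambda>r. Lp_norm_circle p (\<lambda>\<xi>. dilate u r \<xi> - ustar \<xi>)) \<longlongrightarrow> 0) (at_left 1)"
  proof -
    have "((\<lambda>r. \<integral>\<^sup>+\<theta>. ennreal (norm (f r \<theta> - T \<theta>) powr p) \<partial>arc_measure) \<longlongrightarrow> (\<integral>\<^sup>+\<theta>. 0 \<partial>arc_measure)) (at_left 1)"
    \<comment> \<open>At \<open>t = 0\<close>, \<open>W\<close> is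
      \<open>2 powr p * (w \<theta> + w \<theta>)\<close>, one \<open>w\<close> for
      \<open>f r\<close> and one for \<open>T\<close>.\<close>
    proof (rule nn_integral_dominated_convergence_at_left[where w = "\<lambda>\<theta>. 1 * W 0 \<theta>"])
      fix r :: real assume r: "0 < r" "r < 1"
      show "(\<lambda>\<theta>. ennreal (norm (f r \<theta> - T \<theta>) powr p)) \<in> borel_measurable arc_measure"
        using fm[OF less_imp_le[OF r(1)] r(2)] by measurable
      show "AE \<theta> in arc_measure. ennreal (norm (f r \<theta> - T \<theta>) powr p) \<le> 1 * W 0 \<theta>"
        using r p unfolding W_def mult_1 add_0_right
        by (intro AE_I2 order_trans[OF norm_diff_powr_le] mult_left_mono add_mono fle Tle) auto
    next
      show "AE \<theta> in arc_measure. ((\<lambda>r. ennreal (norm (f r \<theta> - T \<theta>) powr p)) \<longlongrightarrow> 0) (at_left 1)"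
        using wAE[of 0]
      proof eventually_elim
        case (elim \<theta>)
        have "((\<lambda>r. ennreal (norm (f r \<theta> - T \<theta>) powr p)) \<longlongrightarrow> ennreal (norm (T \<theta> - T \<theta>) powr p)) (at_left 1)"
          using elim by (intro tendsto_ennreal_norm_powr tendsto_diff tendsto_const conv p) auto
        then show ?case by simp
      qed
    qed (use Wfin[of 1] in auto)
    from tendsto_ennreal_powr[OF this, of "1 / p"]
    have "((\<lambda>r. ennreal_powr (\<integral>\<^sup>+\<theta>. ennreal (norm (f r \<theta> - T \<theta>) powr p) \<partial>arc_measure) (1 / p)) \<longlongrightarrow> 0) (at_left 1)"
      using p by (simp add: powr0)
    moreover have "\<forall>\<^sub>F r in at_left 1. ennreal_powr (\<integral>\<^sup>+\<theta>. ennreal (norm (f r \<theta> - T \<theta>) powr p) \<partial>arc_measure) (1 / p)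
       = Lp_norm_circle p (\<lambda>\<xi>. dilate u r \<xi> - ustar \<xi>)"
      using ev
    proof eventually_elim
      case (elim r)
      then have [measurable]: "f r \<in> borel_measurable borel" by (intro fm) auto
      have "(\<lambda>t. f r t - T t) \<in> borel_measurable borel"
        by (intro borel_measurable_diff) measurable
      then show ?case by (subst Lp_norm_circle_eq) (auto simp: f_def T_def dilate_def)
    qed
    ultimately show ?thesis by (rule Lim_transform_eventually)
  qed
  have gag_ustar: "gagliardo_seminorm s p ustar = ennreal_powr (\<integral>\<^sup>+t. mT t * k t \<partial>arc_measure) (1 / p)"
    using Tm gT by (subst gagliardo_seminorm_eq) (auto simp: T_def)
  have sobolev: "ustar \<in> sobolev_circle s p"
    using Lp gTfin by (simp add: sobolev_circle_def gag_ustar)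
  have gag_diff_lim: "((\<lambda>r. gagliardo_seminorm s p (\<lambda>\<xi>. dilate u r \<xi> - ustar \<xi>)) \<longlongrightarrow> 0) (at_left 1)"
  proof (rule Lim_transform_eventually)
    show "((\<lambda>r. ennreal_powr (\<integral>\<^sup>+t. md r t * k t \<partial>arc_measure) (1 / p)) \<longlongrightarrow> 0) (at_left 1)"
      using tendsto_ennreal_powr[OF gd_lim, of "1 / p"] p by (simp add: powr0)
    show "\<forall>\<^sub>F r in at_left 1. ennreal_powr (\<integral>\<^sup>+t. md r t * k t \<partial>arc_measure) (1 / p)
        = gagliardo_seminorm s p (\<lambda>\<xi>. dilate u r \<xi> - ustar \<xi>)"
      using ev
    proof eventually_elim
      case (elim r)
      then have [measurable]: "f r \<in> borel_measurable borel" by (intro fm) auto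
      have "(\<lambda>t. f r t - T t) \<in> borel_measurable borel"
        by (intro borel_measurable_diff) measurable
      then show ?case using gd[of r] elim
        by (subst gagliardo_seminorm_eq) (auto simp: f_def T_def dilate_def)
    qed
  qed
  \<comment> \<open>Taken directly from the limit of the integrals \<open>gf_lim\<close>, rather
    than from a triangle inequality for the seminorm.\<close>
  have gag_lim: "((\<lambda>r. gagliardo_seminorm s p (dilate u r)) \<longlongrightarrow> gagliardo_seminorm s p ustar) (at_left 1)"
  proof (rule Lim_transform_eventually)
    show "((\<lambda>r. ennreal_powr (\<integral>\<^sup>+t. mf r t * k t \<partial>arc_measure) (1 / p)) \<longlongrightarrow> gagliardo_seminorm s p ustar) (at_left 1)"
      unfolding gag_ustar using p by (intro tendsto_ennreal_powr gf_lim gTfin) auto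
    show "\<forall>\<^sub>F r in at_left 1. ennreal_powr (\<integral>\<^sup>+t. mf r t * k t \<partial>arc_measure) (1 / p)
        = gagliardo_seminorm s p (dilate u r)"
      using ev
    proof eventually_elim
      case (elim r)
      then show ?case using gf[of r] fm[of r]
        by (subst gagliardo_seminorm_eq) (auto simp: f_def dilate_def)
    qed
  qed
  show ?thesis
    using hardy Lp radial Lp_lim sobolev gag_diff_lim gag_lim by blast
qed

end
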